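(* Let $\mathscr{C}$ be a pivotal $\Bbbk$-category over an integral domain $\Bbbk$, and let $(P,\alpha,\beta,\eta,\epsilon)$ be a trace tuple in $\mathscr{C}$. Then there exists a right $(\alpha,\beta)$-trace $\mathsf{t}$ on $I_\alpha^\beta$ defined, for $V\in I_\alpha^\beta$ and $f\in\operatorname{Hom}_{\mathscr{C}}(\alpha\otimes V,\beta\otimes V)$, by $$\mathsf{t}_V(f)=\langle \operatorname{tr}_r^V(\tau_V f)\rangle_\eta=\langle \operatorname{tr}_r^V(f\sigma_V)\rangle_\epsilon,$$ where $\sigma_V:P\otimes V\to\alpha\otimes V$ and $\tau_V:\beta\otimes V\to P\otimes V$ are any morphisms satisfying $\sigma_V(\eta\otimes\operatorname{Id}_V)=\operatorname{Id}_{\alpha\otimes V}$ and $(\epsilon\otimes\operatorname{Id}_V)\tau_V=\operatorname{Id}_{\beta\otimes V}$.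
   Context: Composition of morphisms is written $fg=f\circ g$. A pivotal $\Bbbk$-category is a strict monoidal category $\mathscr{C}$ that is additive, with hom-sets $\Bbbk$-modules and with $\Bbbk$-bilinear composition and tensor product, such that $\Bbbk\to\operatorname{End}_{\mathscr{C}}(\mathbf{1})$, $k\mapsto k\operatorname{Id}_{\mathbf 1}$, is an isomorphism ($\mathbf{1}$ is the unit object), and such that each object $V$ has a dual $V^*$ with morphisms $\operatorname{coev}_V:\mathbf 1\to V\otimes V^*$, $\operatorname{ev}_V:V^*\otimes V\to\mathbf 1$ (left duality) and $\widetilde{\operatorname{coev}}_V:\mathbf 1\to V^*\otimes V$, $\widetilde{\operatorname{ev}}_V:V\otimes V^*\to\mathbf 1$ (right duality) satisfying the zig-zag identities, for which the left and right duals of each morphism coincide and the two canonical isomorphisms $W^*\otimes V^*\to (V\otimes W)^*$ obtained from the left and right duality coincide (these isomorphisms are taken to be identities). Right ideal: a full subcategory $I$ such that (i) $V\in I$, $W\in\mathscr{C}$ imply $V\otimes W\in I$; (ii) if $V\in I$ and there are $f:W\to V$, $g:V\to W$ with $gf=\operatorname{Id}_W$, then $W\in I$. Right partial trace: for $g\in\operatorname{Hom}_{\mathscr{C}}(V\otimes W,X\otimes W)$, $\operatorname{tr}_r^W(g)=(\operatorname{Id}_X\otimes\widetilde{\operatorname{ev}}_W)(g\otimes\operatorname{Id}_{W^*})(\operatorname{Id}_V\otimes\operatorname{coev}_W)\in\operatorname{Hom}_{\mathscr{C}}(V,X)$. Right $(\alpha,\beta)$-trace on a right ideal $I$: a family of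 $\Bbbk$-linear maps $\mathsf{t}_V:\operatorname{Hom}_{\mathscr{C}}(\alpha\otimes V,\beta\otimes V)\to\Bbbk$, $V\in I$, with (1) $\mathsf{t}_{U\otimes W}(f)=\mathsf{t}_U(\operatorname{tr}_r^W(f))$ for $U\in I$, $W\in\mathscr{C}$, $f:\alpha\otimes U\otimes W\to\beta\otimes U\otimes W$; (2) $\mathsf{t}_V((\operatorname{Id}_\beta\otimes g)f)=\mathsf{t}_U(f(\operatorname{Id}_\alpha\otimes g))$ for $U,V\in I$, $f:\alpha\otimes V\to\beta\otimes U$, $g:U\to V$. An object $V$ is absolutely indecomposable if $\operatorname{End}_{\mathscr{C}}(V)/\operatorname{J}(\operatorname{End}_{\mathscr{C}}(V))\cong\Bbbk$, where $\operatorname{J}$ is the Jacobson radical; it is moreover end-nilpotent if $\operatorname{J}(\operatorname{End}_{\mathscr{C}}(V))$ is nilpotent. Trace tuple: $(P,\alpha,\beta,\eta,\epsilon)$ with $P,\alpha,\beta$ objects and $\eta:\alpha\to P$, $\epsilon:P\to\beta$ nonzero morphisms such that $P$ is absolutely indecomposable and end-nilpotent, and $\operatorname{Hom}_{\mathscr{C}}(\alpha,P)$, $\operatorname{Hom}_{\mathscr{C}}(P,\beta)$ are free $\Bbbk$-modules generated by $\eta$ and $\epsilon$ respectively. For a trace tuple: $I_\alpha$ is the class (full subcategory) of objects $V$ for which there is $\sigma_V:P\otimes V\to\alpha\otimes V$ with $\sigma_V(\eta\otimes\operatorname{Id}_V)=\operatorname{Id}_{\alpha\otimes V}$; $I^\beta$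 that of objects $V$ for which there is $\tau_V:\beta\otimes V\to P\otimes V$ with $(\epsilon\otimes\operatorname{Id}_V)\tau_V=\operatorname{Id}_{\beta\otimes V}$; and $I_\alpha^\beta=I_\alpha\cap I^\beta$, which is a right ideal. For $g\in\operatorname{Hom}_{\mathscr{C}}(\alpha,P)$ and $h\in\operatorname{Hom}_{\mathscr{C}}(P,\beta)$, the scalars $\langle g\rangle_\eta,\langle h\rangle_\epsilon\in\Bbbk$ are defined by $g=\langle g\rangle_\eta\,\eta$ and $h=\langle h\rangle_\epsilon\,\epsilon$. *)

theory Defs
  imports "HOL-Algebra.QuotRing" "HOL-Algebra.Ideal_Product" "HOL-Algebra.Module"
begin

section \<open>Jacobson radical and powers of ideals of a (possibly noncommutative) ring\<close>

text \<open>The ideals of \<^theory>\<open>HOL-Algebra.Ideal\<close> are two-sided, so one-sided ideals are introduced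
  here.  For the zero ring there is no maximal left ideal and the radical is the whole ring.\<close>

definition left_ideal :: "'a set \<Rightarrow> ('a, 'b) ring_scheme \<Rightarrow> bool" where
  "left_ideal I R \<longleftrightarrow>
     additive_subgroup I R \<and> (\<forall>x\<in>carrier R. \<forall>a\<in>I. x \<otimes>\<^bsub>R\<^esub> a \<in> I)"

definition maximal_left_ideal :: "'a set \<Rightarrow> ('a, 'b) ring_scheme \<Rightarrow> bool" where
  "maximal_left_ideal I R \<longleftrightarrow>
     left_ideal I R \<and> I \<noteq> carrier R \<and>
     (\<forall>J. left_ideal J R \<longrightarrow> I \<subseteq> J \<longrightarrow> J = I \<or> J = carrier R)"

definition jacobson_radical :: "('a, 'b) ring_scheme \<Rightarrow> 'a set" where
  "jacobson_radical R = carrier R \<inter> \<Inter>{I. maximal_left_ideal I R}"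

primrec ideal_power :: "('a, 'b) ring_scheme \<Rightarrow> 'a set \<Rightarrow> nat \<Rightarrow> 'a set" where
  "ideal_power R I 0 = carrier R"
| "ideal_power R I (Suc n) = ideal_prod R (ideal_power R I n) I"

definition nilpotent_ideal :: "('a, 'b) ring_scheme \<Rightarrow> 'a set \<Rightarrow> bool" where
  "nilpotent_ideal R I \<longleftrightarrow> (\<exists>n. ideal_power R I n = {\<zero>\<^bsub>R\<^esub>})"

definition free_on_generator ::
    "('k, 'r) ring_scheme \<Rightarrow> ('k, 'a, 'b) module_scheme \<Rightarrow> 'a \<Rightarrow> bool" where
  "free_on_generator K M x \<longleftrightarrow>
     x \<in> carrier M \<and> (\<forall>y\<in>carrier M. \<exists>!k. k \<in> carrier K \<and> y = k \<odot>\<^bsub>M\<^esub> x)"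


section \<open>Strict monoidal categories\<close>

text \<open>The composite \<open>g \<bullet> f\<close> means ``first \<open>f\<close>, then \<open>g\<close>''.  Objects and morphisms are
  elements of two types; all operations are meaningful only on \<open>Obj\<close> and \<open>Mor\<close>.\<close>

record ('o, 'm) cat =
  Obj :: "'o set"
  Mor :: "'m set"
  Dom :: "'m \<Rightarrow> 'o"
  Cod :: "'m \<Rightarrow> 'o"
  idm :: "'o \<Rightarrow> 'm"
  comp :: "'m \<Rightarrow> 'm \<Rightarrow> 'm"  (infixl \<open>\<bullet>\<index>\<close> 70)

definition Hom :: "('o, 'm, 'x) cat_scheme \<Rightarrow> 'o \<Rightarrow> 'o \<Rightarrow> 'm set" where
  "Hom C V W = {f \<in> Mor C. Dom C f = V \<and> Cod C f = W}"

locale category =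
  fixes C :: "('o, 'm, 'x) cat_scheme" (structure)
  assumes Dom_Obj: "f \<in> Mor C \<Longrightarrow> Dom C f \<in> Obj C"
    and Cod_Obj: "f \<in> Mor C \<Longrightarrow> Cod C f \<in> Obj C"
    and idm_Hom: "V \<in> Obj C \<Longrightarrow> idm C V \<in> Hom C V V"
    and comp_Hom: "f \<in> Hom C U V \<Longrightarrow> g \<in> Hom C V W \<Longrightarrow> g \<bullet> f \<in> Hom C U W"
    and comp_idm: "f \<in> Hom C U V \<Longrightarrow> f \<bullet> idm C U = f"
    and idm_comp: "f \<in> Hom C U V \<Longrightarrow> idm C V \<bullet> f = f"
    and comp_assoc: "f \<in> Hom C U V \<Longrightarrow> g \<in> Hom C V W \<Longrightarrow> h \<in> Hom C W X \<Longrightarrow>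
          (h \<bullet> g) \<bullet> f = h \<bullet> (g \<bullet> f)"

record ('o, 'm) monoidal_cat = "('o, 'm) cat" +
  unit_obj :: 'o  (\<open>\<^bold>1\<index>\<close>)
  tensor_obj :: "'o \<Rightarrow> 'o \<Rightarrow> 'o"  (infixl \<open>\<otimes>\<^sub>o\<index>\<close> 75)
  tensor_mor :: "'m \<Rightarrow> 'm \<Rightarrow> 'm"  (infixl \<open>\<otimes>\<^sub>m\<index>\<close> 75)

locale strict_monoidal_category = category C
  for C :: "('o, 'm, 'x) monoidal_cat_scheme" (structure) +
  assumes unit_Obj: "\<^bold>1 \<in> Obj C"
    and tensor_Obj: "V \<in> Obj C \<Longrightarrow> W \<in> Obj C \<Longrightarrow> V \<otimes>\<^sub>o W \<in> Obj C"
    and tensor_Hom: "f \<in> Hom C U V \<Longrightarrow> g \<in> Hom C X Y \<Longrightarrow>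
          f \<otimes>\<^sub>m g \<in> Hom C (U \<otimes>\<^sub>o X) (V \<otimes>\<^sub>o Y)"
    and tensor_idm: "V \<in> Obj C \<Longrightarrow> W \<in> Obj C \<Longrightarrow> idm C V \<otimes>\<^sub>m idm C W = idm C (V \<otimes>\<^sub>o W)"
    and interchange: "f \<in> Hom C U V \<Longrightarrow> g \<in> Hom C V W \<Longrightarrow> f' \<in> Hom C U' V' \<Longrightarrow> g' \<in> Hom C V' W' \<Longrightarrow>
          (g \<bullet> f) \<otimes>\<^sub>m (g' \<bullet> f') = (g \<otimes>\<^sub>m g') \<bullet> (f \<otimes>\<^sub>m f')"
    and tensor_Obj_assoc: "U \<in> Obj C \<Longrightarrow> V \<in> Obj C \<Longrightarrow> W \<in> Obj C \<Longrightarrow>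
          (U \<otimes>\<^sub>o V) \<otimes>\<^sub>o W = U \<otimes>\<^sub>o (V \<otimes>\<^sub>o W)"
    and tensor_Mor_assoc: "f \<in> Mor C \<Longrightarrow> g \<in> Mor C \<Longrightarrow> h \<in> Mor C \<Longrightarrow>
          (f \<otimes>\<^sub>m g) \<otimes>\<^sub>m h = f \<otimes>\<^sub>m (g \<otimes>\<^sub>m h)"
    and unit_tensor_Obj: "V \<in> Obj C \<Longrightarrow> \<^bold>1 \<otimes>\<^sub>o V = V"
    and tensor_unit_Obj: "V \<in> Obj C \<Longrightarrow> V \<otimes>\<^sub>o \<^bold>1 = V"
    and unit_tensor_Mor: "f \<in> Mor C \<Longrightarrow> idm C \<^bold>1 \<otimes>\<^sub>m f = f"
    and tensor_unit_Mor: "f \<in> Mor C \<Longrightarrow> f \<otimes>\<^sub>m idm C \<^bold>1 = f"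


section \<open>Linear additive monoidal categories\<close>

record ('o, 'm, 'k) linear_cat = "('o, 'm) monoidal_cat" +
  add_mor :: "'m \<Rightarrow> 'm \<Rightarrow> 'm"
  zero_mor :: "'o \<Rightarrow> 'o \<Rightarrow> 'm"
  scale_mor :: "'k \<Rightarrow> 'm \<Rightarrow> 'm"

text \<open>A \<^typ>\<open>('k, 'm) module\<close> record carries multiplicative fields, which the locale \<^locale>\<open>module\<close>
  does not constrain; they are left undefined here.\<close>

definition hom_module ::
    "('o, 'm, 'k, 'x) linear_cat_scheme \<Rightarrow> 'o \<Rightarrow> 'o \<Rightarrow> ('k, 'm) module" where
  "hom_module C V W =
     \<lparr>carrier = Hom C V W, mult = undefined, one = undefined,
      zero = zero_mor C V W, add = add_mor C, smult = scale_mor C\<rparr>"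

definition End_ring :: "('o, 'm, 'k, 'x) linear_cat_scheme \<Rightarrow> 'o \<Rightarrow> 'm ring" where
  "End_ring C V =
     \<lparr>carrier = Hom C V V, mult = comp C, one = idm C V,
      zero = zero_mor C V V, add = add_mor C\<rparr>"

locale linear_monoidal_category = strict_monoidal_category C + K: cring K
  for K :: "('k, 'r) ring_scheme"
    and C :: "('o, 'm, 'k, 'x) linear_cat_scheme" (structure) +
  assumes hom_is_module: "V \<in> Obj C \<Longrightarrow> W \<in> Obj C \<Longrightarrow> module K (hom_module C V W)"
    and comp_add_left: "f \<in> Hom C U V \<Longrightarrow> g \<in> Hom C V W \<Longrightarrow> g' \<in> Hom C V W \<Longrightarrow>
          add_mor C g g' \<bullet> f = add_mor C (g \<bullet> f) (g' \<bullet> f)"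
    and comp_add_right: "f \<in> Hom C U V \<Longrightarrow> f' \<in> Hom C U V \<Longrightarrow> g \<in> Hom C V W \<Longrightarrow>
          g \<bullet> add_mor C f f' = add_mor C (g \<bullet> f) (g \<bullet> f')"
    and comp_scale_left: "k \<in> carrier K \<Longrightarrow> f \<in> Hom C U V \<Longrightarrow> g \<in> Hom C V W \<Longrightarrow>
          scale_mor C k g \<bullet> f = scale_mor C k (g \<bullet> f)"
    and comp_scale_right: "k \<in> carrier K \<Longrightarrow> f \<in> Hom C U V \<Longrightarrow> g \<in> Hom C V W \<Longrightarrow>
          g \<bullet> scale_mor C k f = scale_mor C k (g \<bullet> f)"
    and tensor_add_left: "f \<in> Hom C U V \<Longrightarrow> f' \<in> Hom C U V \<Longrightarrow> g \<in> Hom C X Y \<Longrightarrow>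
          add_mor C f f' \<otimes>\<^sub>m g = add_mor C (f \<otimes>\<^sub>m g) (f' \<otimes>\<^sub>m g)"
    and tensor_add_right: "f \<in> Hom C U V \<Longrightarrow> g \<in> Hom C X Y \<Longrightarrow> g' \<in> Hom C X Y \<Longrightarrow>
          f \<otimes>\<^sub>m add_mor C g g' = add_mor C (f \<otimes>\<^sub>m g) (f \<otimes>\<^sub>m g')"
    and tensor_scale_left: "k \<in> carrier K \<Longrightarrow> f \<in> Hom C U V \<Longrightarrow> g \<in> Hom C X Y \<Longrightarrow>
          scale_mor C k f \<otimes>\<^sub>m g = scale_mor C k (f \<otimes>\<^sub>m g)"
    and tensor_scale_right: "k \<in> carrier K \<Longrightarrow> f \<in> Hom C U V \<Longrightarrow> g \<in> Hom C X Y \<Longrightarrow>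
          f \<otimes>\<^sub>m scale_mor C k g = scale_mor C k (f \<otimes>\<^sub>m g)"
    and zero_object: "\<exists>Z\<in>Obj C. \<forall>V\<in>Obj C. (\<exists>f. Hom C Z V = {f}) \<and> (\<exists>g. Hom C V Z = {g})"
    and biproducts: "V \<in> Obj C \<Longrightarrow> W \<in> Obj C \<Longrightarrow>
          \<exists>S\<in>Obj C. \<exists>i\<in>Hom C V S. \<exists>j\<in>Hom C W S. \<exists>p\<in>Hom C S V. \<exists>q\<in>Hom C S W.
            p \<bullet> i = idm C V \<and> q \<bullet> j = idm C W \<and>
            p \<bullet> j = zero_mor C W V \<and> q \<bullet> i = zero_mor C V W \<and>
            add_mor C (i \<bullet> p) (j \<bullet> q) = idm C S"
    and scalars_iso_End_unit: "(\<lambda>k. scale_mor C k (idm C \<^bold>1)) \<in> ring_iso K (End_ring C \<^bold>1)"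


section \<open>Pivotal categories\<close>

text \<open>\<open>ev\<close>, \<open>coev\<close> belong to the left duality, \<open>evr\<close>, \<open>coevr\<close> (written with a tilde on paper) to
  the right duality.\<close>

record ('o, 'm, 'k) pivotal_cat = "('o, 'm, 'k) linear_cat" +
  dual :: "'o \<Rightarrow> 'o"
  coev :: "'o \<Rightarrow> 'm"
  ev :: "'o \<Rightarrow> 'm"
  coevr :: "'o \<Rightarrow> 'm"
  evr :: "'o \<Rightarrow> 'm"

context
  fixes C :: "('o, 'm, 'k, 'x) pivotal_cat_scheme" (structure)
begin

definition left_dual_mor :: "'o \<Rightarrow> 'o \<Rightarrow> 'm \<Rightarrow> 'm" where
  "left_dual_mor V W f =
     (ev C W \<otimes>\<^sub>m idm C (dual C V))
     \<bullet> (idm C (dual C W) \<otimes>\<^sub>m f \<otimes>\<^sub>m idm C (dual C V))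
     \<bullet> (idm C (dual C W) \<otimes>\<^sub>m coev C V)"

definition right_dual_mor :: "'o \<Rightarrow> 'o \<Rightarrow> 'm \<Rightarrow> 'm" where
  "right_dual_mor V W f =
     (idm C (dual C V) \<otimes>\<^sub>m evr C W)
     \<bullet> (idm C (dual C V) \<otimes>\<^sub>m f \<otimes>\<^sub>m idm C (dual C W))
     \<bullet> (coevr C V \<otimes>\<^sub>m idm C (dual C W))"

text \<open>The two canonical isomorphisms from \<open>dual W \<otimes> dual V\<close> to \<open>dual (V \<otimes> W)\<close>.\<close>

definition left_dual_tensor :: "'o \<Rightarrow> 'o \<Rightarrow> 'm" where
  "left_dual_tensor V W =
     (ev C W \<otimes>\<^sub>m idm C (dual C (V \<otimes>\<^sub>o W)))
     \<bullet> (idm C (dual C W) \<otimes>\<^sub>m ev C V \<otimes>\<^sub>m idm C W \<otimes>\<^sub>m idm C (dual C (V \<otimes>\<^sub>o W)))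
     \<bullet> (idm C (dual C W) \<otimes>\<^sub>m idm C (dual C V) \<otimes>\<^sub>m coev C (V \<otimes>\<^sub>o W))"

definition right_dual_tensor :: "'o \<Rightarrow> 'o \<Rightarrow> 'm" where
  "right_dual_tensor V W =
     (idm C (dual C (V \<otimes>\<^sub>o W)) \<otimes>\<^sub>m evr C V)
     \<bullet> (idm C (dual C (V \<otimes>\<^sub>o W)) \<otimes>\<^sub>m idm C V \<otimes>\<^sub>m evr C W \<otimes>\<^sub>m idm C (dual C V))
     \<bullet> (coevr C (V \<otimes>\<^sub>o W) \<otimes>\<^sub>m idm C (dual C W) \<otimes>\<^sub>m idm C (dual C V))"

end

text \<open>The common value of the two canonical isomorphisms is not required to be an identity:
  this covers the strictified convention as the special case in which
  \<open>dual (V \<otimes> W) = dual W \<otimes> dual V\<close> and both isomorphisms are identities.\<close>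

locale pivotal_category = linear_monoidal_category K C
  for K :: "('k, 'r) ring_scheme"
    and C :: "('o, 'm, 'k, 'x) pivotal_cat_scheme" (structure) +
  assumes dual_Obj: "V \<in> Obj C \<Longrightarrow> dual C V \<in> Obj C"
    and coev_Hom: "V \<in> Obj C \<Longrightarrow> coev C V \<in> Hom C \<^bold>1 (V \<otimes>\<^sub>o dual C V)"
    and ev_Hom: "V \<in> Obj C \<Longrightarrow> ev C V \<in> Hom C (dual C V \<otimes>\<^sub>o V) \<^bold>1"
    and coevr_Hom: "V \<in> Obj C \<Longrightarrow> coevr C V \<in> Hom C \<^bold>1 (dual C V \<otimes>\<^sub>o V)"
    and evr_Hom: "V \<in> Obj C \<Longrightarrow> evr C V \<in> Hom C (V \<otimes>\<^sub>o dual C V) \<^bold>1"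
    and left_zigzag: "V \<in> Obj C \<Longrightarrow>
          (idm C V \<otimes>\<^sub>m ev C V) \<bullet> (coev C V \<otimes>\<^sub>m idm C V) = idm C V"
    and left_zigzag_dual: "V \<in> Obj C \<Longrightarrow>
          (ev C V \<otimes>\<^sub>m idm C (dual C V)) \<bullet> (idm C (dual C V) \<otimes>\<^sub>m coev C V) = idm C (dual C V)"
    and right_zigzag: "V \<in> Obj C \<Longrightarrow>
          (evr C V \<otimes>\<^sub>m idm C V) \<bullet> (idm C V \<otimes>\<^sub>m coevr C V) = idm C V"
    and right_zigzag_dual: "V \<in> Obj C \<Longrightarrow>
          (idm C (dual C V) \<otimes>\<^sub>m evr C V) \<bullet> (coevr C V \<otimes>\<^sub>m idm C (dual C V)) = idm C (dual C V)"
    and dual_mor_eq: "V \<in> Obj C \<Longrightarrow> W \<in> Obj C \<Longrightarrow> f \<in> Hom C V W \<Longrightarrow>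
          left_dual_mor C V W f = right_dual_mor C V W f"
    and dual_tensor_eq: "V \<in> Obj C \<Longrightarrow> W \<in> Obj C \<Longrightarrow>
          left_dual_tensor C V W = right_dual_tensor C V W"


section \<open>Right ideals, partial traces and right traces\<close>

text \<open>A full subcategory is represented by its set of objects.\<close>

definition right_ideal :: "('o, 'm, 'x) monoidal_cat_scheme \<Rightarrow> 'o set \<Rightarrow> bool" where
  "right_ideal C I \<longleftrightarrow>
     I \<subseteq> Obj C \<and>
     (\<forall>V\<in>I. \<forall>W\<in>Obj C. V \<otimes>\<^sub>o\<^bsub>C\<^esub> W \<in> I) \<and>
     (\<forall>V\<in>I. \<forall>W\<in>Obj C. \<forall>f\<in>Hom C W V. \<forall>g\<in>Hom C V W. g \<bullet>\<^bsub>C\<^esub> f = idm C W \<longrightarrow> W \<in> I)"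

text \<open>The objects \<open>V\<close>, \<open>X\<close> are arguments because they cannot be recovered from the source
  \<open>V \<otimes> W\<close> and the target \<open>X \<otimes> W\<close> of \<open>g\<close>.\<close>

definition right_ptrace ::
    "('o, 'm, 'k, 'x) pivotal_cat_scheme \<Rightarrow> 'o \<Rightarrow> 'o \<Rightarrow> 'o \<Rightarrow> 'm \<Rightarrow> 'm" where
  "right_ptrace C V X W g =
     (idm C X \<otimes>\<^sub>m\<^bsub>C\<^esub> evr C W)
     \<bullet>\<^bsub>C\<^esub> (g \<otimes>\<^sub>m\<^bsub>C\<^esub> idm C (dual C W))
     \<bullet>\<^bsub>C\<^esub> (idm C V \<otimes>\<^sub>m\<^bsub>C\<^esub> coev C W)"

locale right_trace =
  fixes K :: "('k, 'r) ring_scheme"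
    and C :: "('o, 'm, 'k, 'x) pivotal_cat_scheme" (structure)
    and \<alpha> \<beta> :: 'o
    and I :: "'o set"
    and t :: "'o \<Rightarrow> 'm \<Rightarrow> 'k"
  assumes ideal: "right_ideal C I"
    and closed: "V \<in> I \<Longrightarrow> f \<in> Hom C (\<alpha> \<otimes>\<^sub>o V) (\<beta> \<otimes>\<^sub>o V) \<Longrightarrow> t V f \<in> carrier K"
    and additive: "V \<in> I \<Longrightarrow> f \<in> Hom C (\<alpha> \<otimes>\<^sub>o V) (\<beta> \<otimes>\<^sub>o V) \<Longrightarrow> g \<in> Hom C (\<alpha> \<otimes>\<^sub>o V) (\<beta> \<otimes>\<^sub>o V) \<Longrightarrow>
          t V (add_mor C f g) = t V f \<oplus>\<^bsub>K\<^esub> t V g"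
    and homogeneous: "V \<in> I \<Longrightarrow> k \<in> carrier K \<Longrightarrow> f \<in> Hom C (\<alpha> \<otimes>\<^sub>o V) (\<beta> \<otimes>\<^sub>o V) \<Longrightarrow>
          t V (scale_mor C k f) = k \<otimes>\<^bsub>K\<^esub> t V f"
    and partial_trace: "U \<in> I \<Longrightarrow> W \<in> Obj C \<Longrightarrow>
          f \<in> Hom C (\<alpha> \<otimes>\<^sub>o U \<otimes>\<^sub>o W) (\<beta> \<otimes>\<^sub>o U \<otimes>\<^sub>o W) \<Longrightarrow>
          t (U \<otimes>\<^sub>o W) f = t U (right_ptrace C (\<alpha> \<otimes>\<^sub>o U) (\<beta> \<otimes>\<^sub>o U) W f)"
    and cyclic: "U \<in> I \<Longrightarrow> V \<in> I \<Longrightarrow> f \<in> Hom C (\<alpha> \<otimes>\<^sub>o V) (\<beta> \<otimes>\<^sub>o U) \<Longrightarrow> g \<in> Hom C U V \<Longrightarrow>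
          t V ((idm C \<beta> \<otimes>\<^sub>m g) \<bullet> f) = t U (f \<bullet> (idm C \<alpha> \<otimes>\<^sub>m g))"


section \<open>Trace tuples\<close>

text \<open>The isomorphism with the ground ring is one of algebras, i.e. a linear ring isomorphism.\<close>

definition absolutely_indecomposable ::
    "('k, 'r) ring_scheme \<Rightarrow> ('o, 'm, 'k, 'x) linear_cat_scheme \<Rightarrow> 'o \<Rightarrow> bool" where
  "absolutely_indecomposable K C V \<longleftrightarrow>
     (let E = End_ring C V; J = jacobson_radical E in
      \<exists>\<phi>\<in>ring_iso (E Quot J) K.
        \<forall>k\<in>carrier K. \<forall>f\<in>carrier E.
          \<phi> (J +>\<^bsub>E\<^esub> scale_mor C k f) = k \<otimes>\<^bsub>K\<^esub> \<phi> (J +>\<^bsub>E\<^esub> f))"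

definition end_nilpotent :: "('o, 'm, 'k, 'x) linear_cat_scheme \<Rightarrow> 'o \<Rightarrow> bool" where
  "end_nilpotent C V \<longleftrightarrow> nilpotent_ideal (End_ring C V) (jacobson_radical (End_ring C V))"

locale trace_tuple =
  fixes K :: "('k, 'r) ring_scheme"
    and C :: "('o, 'm, 'k, 'x) linear_cat_scheme" (structure)
    and P \<alpha> \<beta> :: 'o
    and \<eta> \<epsilon> :: 'm
  assumes P_Obj: "P \<in> Obj C"
    and \<alpha>_Obj: "\<alpha> \<in> Obj C"
    and \<beta>_Obj: "\<beta> \<in> Obj C"
    and \<eta>_Hom: "\<eta> \<in> Hom C \<alpha> P"
    and \<epsilon>_Hom: "\<epsilon> \<in> Hom C P \<beta>"
    and \<eta>_nonzero: "\<eta> \<noteq> zero_mor C \<alpha> P"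
    and \<epsilon>_nonzero: "\<epsilon> \<noteq> zero_mor C P \<beta>"
    and P_absolutely_indecomposable: "absolutely_indecomposable K C P"
    and P_end_nilpotent: "end_nilpotent C P"
    and \<eta>_free: "free_on_generator K (hom_module C \<alpha> P) \<eta>"
    and \<epsilon>_free: "free_on_generator K (hom_module C P \<beta>) \<epsilon>"

context
  fixes C :: "('o, 'm, 'k, 'x) linear_cat_scheme" (structure)
begin

definition is_sigma :: "'o \<Rightarrow> 'o \<Rightarrow> 'm \<Rightarrow> 'o \<Rightarrow> 'm \<Rightarrow> bool" where
  "is_sigma P \<alpha> \<eta> V \<sigma> \<longleftrightarrow>
     \<sigma> \<in> Hom C (P \<otimes>\<^sub>o V) (\<alpha> \<otimes>\<^sub>o V) \<and> \<sigma> \<bullet> (\<eta> \<otimes>\<^sub>m idm C V) = idm C (\<alpha> \<otimes>\<^sub>o V)"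

definition is_tau :: "'o \<Rightarrow> 'o \<Rightarrow> 'm \<Rightarrow> 'o \<Rightarrow> 'm \<Rightarrow> bool" where
  "is_tau P \<beta> \<epsilon> V \<tau> \<longleftrightarrow>
     \<tau> \<in> Hom C (\<beta> \<otimes>\<^sub>o V) (P \<otimes>\<^sub>o V) \<and> (\<epsilon> \<otimes>\<^sub>m idm C V) \<bullet> \<tau> = idm C (\<beta> \<otimes>\<^sub>o V)"

definition I_lower :: "'o \<Rightarrow> 'o \<Rightarrow> 'm \<Rightarrow> 'o set" where
  "I_lower P \<alpha> \<eta> = {V \<in> Obj C. \<exists>\<sigma>. is_sigma P \<alpha> \<eta> V \<sigma>}"

definition I_upper :: "'o \<Rightarrow> 'o \<Rightarrow> 'm \<Rightarrow> 'o set" where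
  "I_upper P \<beta> \<epsilon> = {V \<in> Obj C. \<exists>\<tau>. is_tau P \<beta> \<epsilon> V \<tau>}"

definition I_both :: "'o \<Rightarrow> 'o \<Rightarrow> 'o \<Rightarrow> 'm \<Rightarrow> 'm \<Rightarrow> 'o set" where
  "I_both P \<alpha> \<beta> \<eta> \<epsilon> = I_lower P \<alpha> \<eta> \<inter> I_upper P \<beta> \<epsilon>"

end

text \<open>\<open>coefficient K C e g\<close> is the scalar \<open>\<langle>g\<rangle>\<close> with \<open>g = \<langle>g\<rangle> e\<close>, for \<open>e\<close> a free generator of the
  hom-module containing \<open>g\<close>.\<close>

definition coefficient ::
    "('k, 'r) ring_scheme \<Rightarrow> ('o, 'm, 'k, 'x) linear_cat_scheme \<Rightarrow> 'm \<Rightarrow> 'm \<Rightarrow> 'k" where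
  "coefficient K C e g = (THE k. k \<in> carrier K \<and> g = scale_mor C k e)"

end

theory Submission
  imports Defs
begin

text \<open>
  Everything follows from one fact about the object \<open>P\<close>: an endomorphism \<open>G\<close> of \<open>P\<close> acts on
  \<open>\<eta>\<close> (from the left) and on \<open>\<epsilon>\<close> (from the right) by the \<^emph>\<open>same\<close> scalar (\<open>coefficient_End\<close>).
  Indeed absolute indecomposability gives \<open>G = k Id + n\<close> with \<open>n\<close> in the Jacobson radical, hence
  nilpotent.  Since \<open>\<eta>\<close> freely generates its hom-module, \<open>n \<eta> = c \<eta>\<close> for a scalar \<open>c\<close>, and
  \<open>n\<^sup>m = 0\<close> forces \<open>c\<^sup>m = 0\<close>; the ground ring is a domain, so \<open>c = 0\<close>.  Likewise \<open>\<epsilon> n = 0\<close>, and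
  the common scalar is \<open>k\<close>.

  Given \<open>\<sigma>\<close> and \<open>\<tau>\<close> for \<open>V\<close>, apply this to \<open>G = tr(\<tau> f \<sigma>)\<close>, the partial trace over \<open>V\<close>.  Pulling
  \<open>\<eta>\<close> and \<open>\<epsilon>\<close> into the trace and cancelling against \<open>\<sigma>\<close> and \<open>\<tau>\<close> gives \<open>G \<eta> = tr(\<tau> f)\<close> and
  \<open>\<epsilon> G = tr(f \<sigma>)\<close>.  So the two formulas for the trace agree; since one of them does not involve
  \<open>\<sigma>\<close> and the other does not involve \<open>\<tau>\<close>, neither depends on the choices.  The same computation
  with \<open>G = tr(\<tau> f \<sigma> (Id \<otimes> g))\<close>, where now \<open>\<tau>\<close> belongs to \<open>U\<close>, \<open>\<sigma>\<close> to \<open>V\<close> and \<open>g\<close> goes from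
  \<open>U\<close> to \<open>V\<close>, proves the cyclicity axiom; both are the single lemma \<open>sigma_tau_exchange\<close>.  For the
  partial trace axiom one may compute with \<open>\<sigma> \<otimes> Id\<close> on \<open>U \<otimes> W\<close>, and the claim reduces to
  \<open>tr\<^bsub>U\<otimes>W\<^esub> = tr\<^bsub>U\<^esub> tr\<^bsub>W\<^esub>\<close>.

  Thus two properties of partial traces need the pivotal structure: that a morphism of the
  traced factor slides around the loop (\<open>right_ptrace_cyclic\<close>), because left and right dual
  morphisms coincide, and that tracing out a tensor product can be done one factor at a time
  (\<open>right_ptrace_tensor\<close>), because the two canonical morphisms into \<open>(U \<otimes> W)\<^sup>*\<close> coincide.  In both
  cases the left version is adapted to \<open>coev\<close> and the right version to \<open>evr\<close>, the two ends of
  the loop.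
\<close>

section \<open>Calculating in a strict monoidal category\<close>

text \<open>Hom-sets are unfolded into domain and codomain so that the side conditions of the category
  axioms become equations between objects, which the simplifier decides by strict associativity.
  The axioms are restated accordingly.\<close>

context strict_monoidal_category
begin

lemma Hom_iff: "f \<in> Hom C U V \<longleftrightarrow> f \<in> Mor C \<and> Dom C f = U \<and> Cod C f = V"
  by (simp add: Hom_def)

lemma idm_Mor: "V \<in> Obj C \<Longrightarrow> idm C V \<in> Mor C \<and> Dom C (idm C V) = V \<and> Cod C (idm C V) = V"
  using idm_Hom by (simp add: Hom_iff)

lemma comp_Mor:
  assumes "f \<in> Mor C" "g \<in> Mor C" "Cod C f = Dom C g"
  shows "g \<bullet> f \<in> Mor C" "Dom C (g \<bullet> f) = Dom C f" "Cod C (g \<bullet> f) = Cod C g"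
  using comp_Hom[of f "Dom C f" "Dom C g" g "Cod C g"] assms by (simp_all add: Hom_iff)

lemma tensor_Mor:
  assumes "f \<in> Mor C" "g \<in> Mor C"
  shows "f \<otimes>\<^sub>m g \<in> Mor C" "Dom C (f \<otimes>\<^sub>m g) = Dom C f \<otimes>\<^sub>o Dom C g"
    "Cod C (f \<otimes>\<^sub>m g) = Cod C f \<otimes>\<^sub>o Cod C g"
  using tensor_Hom[of f "Dom C f" "Cod C f" g "Dom C g" "Cod C g"] assms by (simp_all add: Hom_iff)

lemmas Mor_simps = Hom_iff Dom_Obj Cod_Obj idm_Mor comp_Mor tensor_Mor
  unit_Obj tensor_Obj tensor_Obj_assoc unit_tensor_Obj tensor_unit_Obj

lemma comp_assoc_Mor:
  assumes "f \<in> Mor C" "g \<in> Mor C" "h \<in> Mor C" "Cod C f = Dom C g" "Cod C g = Dom C h"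
  shows "(h \<bullet> g) \<bullet> f = h \<bullet> (g \<bullet> f)"
  using comp_assoc[of f "Dom C f" "Dom C g" g "Dom C h" h "Cod C h"] assms by (simp add: Hom_iff)

lemma comp_idm_Mor: "f \<in> Mor C \<Longrightarrow> Dom C f = V \<Longrightarrow> f \<bullet> idm C V = f"
  using comp_idm[of f V "Cod C f"] by (simp add: Hom_iff)

lemma idm_comp_Mor: "f \<in> Mor C \<Longrightarrow> Cod C f = V \<Longrightarrow> idm C V \<bullet> f = f"
  using idm_comp[of f "Dom C f" V] by (simp add: Hom_iff)

lemma comp_tensor_comp:
  assumes "f \<in> Mor C" "g \<in> Mor C" "f' \<in> Mor C" "g' \<in> Mor C"
    "Cod C f = Dom C g" "Cod C f' = Dom C g'"
  shows "(g \<otimes>\<^sub>m g') \<bullet> (f \<otimes>\<^sub>m f') = (g \<bullet> f) \<otimes>\<^sub>m (g' \<bullet> f')"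
  using interchange[of f "Dom C f" "Dom C g" g "Cod C g" f' "Dom C f'" "Dom C g'" g' "Cod C g'"] assms
  by (simp add: Hom_iff)

lemma idm_tensor_comp:
  assumes "V \<in> Obj C" "f \<in> Mor C" "g \<in> Mor C" "Cod C f = Dom C g"
  shows "idm C V \<otimes>\<^sub>m (g \<bullet> f) = (idm C V \<otimes>\<^sub>m g) \<bullet> (idm C V \<otimes>\<^sub>m f)"
  using assms by (simp add: comp_tensor_comp comp_idm_Mor Mor_simps)

lemma comp_tensor_idm:
  assumes "V \<in> Obj C" "f \<in> Mor C" "g \<in> Mor C" "Cod C f = Dom C g"
  shows "(g \<bullet> f) \<otimes>\<^sub>m idm C V = (g \<otimes>\<^sub>m idm C V) \<bullet> (f \<otimes>\<^sub>m idm C V)"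
  using assms by (simp add: comp_tensor_comp comp_idm_Mor Mor_simps)

lemma idm_tensor_idm_tensor:
  assumes "V \<in> Obj C" "W \<in> Obj C" "f \<in> Mor C"
  shows "idm C V \<otimes>\<^sub>m (idm C W \<otimes>\<^sub>m f) = idm C (V \<otimes>\<^sub>o W) \<otimes>\<^sub>m f"
  using assms by (simp add: tensor_Mor_assoc[symmetric] tensor_idm Mor_simps)

text \<open>Two morphisms living on different tensor factors commute: both composites are \<open>f \<otimes> g\<close>.  In string
  diagrams, a box slides vertically past a box next to it.\<close>

lemma exchange:
  assumes "f \<in> Hom C U V" "g \<in> Hom C X Y"
  shows "(f \<otimes>\<^sub>m idm C Y) \<bullet> (idm C U \<otimes>\<^sub>m g) = (idm C V \<otimes>\<^sub>m g) \<bullet> (f \<otimes>\<^sub>m idm C X)"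
proof -
  have "U \<in> Obj C" "V \<in> Obj C" "X \<in> Obj C" "Y \<in> Obj C"
    using assms Dom_Obj Cod_Obj by (auto simp: Hom_iff)
  then show ?thesis
    using assms by (simp add: comp_tensor_comp comp_idm_Mor idm_comp_Mor Mor_simps)
qed

end

section \<open>Mates under duality\<close>

context pivotal_category
begin

lemma duality_Mor:
  assumes "V \<in> Obj C"
  shows "coev C V \<in> Mor C" "Dom C (coev C V) = \<^bold>1" "Cod C (coev C V) = V \<otimes>\<^sub>o dual C V"
    "ev C V \<in> Mor C" "Dom C (ev C V) = dual C V \<otimes>\<^sub>o V" "Cod C (ev C V) = \<^bold>1"
    "coevr C V \<in> Mor C" "Dom C (coevr C V) = \<^bold>1" "Cod C (coevr C V) = dual C V \<otimes>\<^sub>o V"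
    "evr C V \<in> Mor C" "Dom C (evr C V) = V \<otimes>\<^sub>o dual C V" "Cod C (evr C V) = \<^bold>1"
  using coev_Hom ev_Hom coevr_Hom evr_Hom assms by (auto simp: Hom_iff)

lemmas piv_simps = Mor_simps duality_Mor dual_Obj

text \<open>Bending the output strand \<open>W\<close> of \<open>x\<close> down with \<open>ev\<close> and then up again with \<open>coev\<close> gives \<open>x\<close>
  back, by the zig-zag identity for \<open>W\<close>.  Left dual morphisms and the left canonical morphism
  into \<open>dual (U \<otimes> W)\<close> are of the bent form, which is how they are recognised below.\<close>

lemma left_mate:
  assumes W: "W \<in> Obj C" and Y: "Y \<in> Obj C" and x: "x \<in> Hom C A (W \<otimes>\<^sub>o Y)"
  shows "(idm C W \<otimes>\<^sub>m ((ev C W \<otimes>\<^sub>m idm C Y) \<bullet> (idm C (dual C W) \<otimes>\<^sub>m x))) \<bullet> (coev C W \<otimes>\<^sub>m idm C A) = x"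
proof -
  have A: "A \<in> Obj C" using x Dom_Obj by (auto simp: Hom_iff)
  note D = W Y A x[unfolded Hom_iff]
  have "(idm C W \<otimes>\<^sub>m ((ev C W \<otimes>\<^sub>m idm C Y) \<bullet> (idm C (dual C W) \<otimes>\<^sub>m x))) \<bullet> (coev C W \<otimes>\<^sub>m idm C A)
      = (idm C W \<otimes>\<^sub>m (ev C W \<otimes>\<^sub>m idm C Y)) \<bullet>
        ((idm C (W \<otimes>\<^sub>o dual C W) \<otimes>\<^sub>m x) \<bullet> (coev C W \<otimes>\<^sub>m idm C A))"
    using D by (simp add: idm_tensor_comp idm_tensor_idm_tensor comp_assoc_Mor piv_simps)
  \<comment> \<open>\<open>coev\<close> starts at the unit object, so sliding \<open>x\<close> past it leaves \<open>x\<close> bare.\<close>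
  also have "(idm C (W \<otimes>\<^sub>o dual C W) \<otimes>\<^sub>m x) \<bullet> (coev C W \<otimes>\<^sub>m idm C A)
      = (coev C W \<otimes>\<^sub>m idm C (W \<otimes>\<^sub>o Y)) \<bullet> x"
    using exchange[OF coev_Hom[OF W] x] D by (simp add: unit_tensor_Mor)
  also have "(idm C W \<otimes>\<^sub>m (ev C W \<otimes>\<^sub>m idm C Y)) \<bullet> ((coev C W \<otimes>\<^sub>m idm C (W \<otimes>\<^sub>o Y)) \<bullet> x)
      = (((idm C W \<otimes>\<^sub>m ev C W) \<otimes>\<^sub>m idm C Y) \<bullet> ((coev C W \<otimes>\<^sub>m idm C W) \<otimes>\<^sub>m idm C Y)) \<bullet> x"
    using D by (simp add: tensor_Mor_assoc tensor_idm comp_assoc_Mor piv_simps)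
  also have "\<dots> = x"
    using D by (simp add: comp_tensor_idm[symmetric] left_zigzag tensor_idm idm_comp_Mor piv_simps)
  finally show ?thesis .
qed

text \<open>The mirror image: the input strand \<open>W\<close> is bent up with \<open>coevr\<close> and straightened with \<open>evr\<close>.\<close>

lemma right_mate:
  assumes W: "W \<in> Obj C" and A: "A \<in> Obj C" and y: "y \<in> Hom C (W \<otimes>\<^sub>o A) Y"
  shows "(evr C W \<otimes>\<^sub>m idm C Y) \<bullet> (idm C W \<otimes>\<^sub>m ((idm C (dual C W) \<otimes>\<^sub>m y) \<bullet> (coevr C W \<otimes>\<^sub>m idm C A))) = y"
proof -
  have Y: "Y \<in> Obj C" using y Cod_Obj by (auto simp: Hom_iff)
  note D = W Y A y[unfolded Hom_iff]
  have "(evr C W \<otimes>\<^sub>m idm C Y) \<bullet> (idm C W \<otimes>\<^sub>m ((idm C (dual C W) \<otimes>\<^sub>m y) \<bullet> (coevr C W \<otimes>\<^sub>m idm C A)))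
      = ((evr C W \<otimes>\<^sub>m idm C Y) \<bullet> (idm C (W \<otimes>\<^sub>o dual C W) \<otimes>\<^sub>m y)) \<bullet>
        (idm C W \<otimes>\<^sub>m (coevr C W \<otimes>\<^sub>m idm C A))"
    using D by (simp add: idm_tensor_comp idm_tensor_idm_tensor comp_assoc_Mor piv_simps)
  also have "(evr C W \<otimes>\<^sub>m idm C Y) \<bullet> (idm C (W \<otimes>\<^sub>o dual C W) \<otimes>\<^sub>m y)
      = y \<bullet> (evr C W \<otimes>\<^sub>m idm C (W \<otimes>\<^sub>o A))"
    using exchange[OF evr_Hom[OF W] y] D by (simp add: unit_tensor_Mor)
  also have "(y \<bullet> (evr C W \<otimes>\<^sub>m idm C (W \<otimes>\<^sub>o A))) \<bullet> (idm C W \<otimes>\<^sub>m (coevr C W \<otimes>\<^sub>m idm C A))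
      = y \<bullet> (((evr C W \<otimes>\<^sub>m idm C W) \<otimes>\<^sub>m idm C A) \<bullet> ((idm C W \<otimes>\<^sub>m coevr C W) \<otimes>\<^sub>m idm C A))"
    using D by (simp add: tensor_Mor_assoc tensor_idm comp_assoc_Mor piv_simps)
  also have "\<dots> = y"
    using D by (simp add: comp_tensor_idm[symmetric] right_zigzag tensor_idm comp_idm_Mor piv_simps)
  finally show ?thesis .
qed

text \<open>The left dual of \<open>f\<close> is the mate of \<open>f\<close> composed with \<open>coev\<close>, so \<open>f\<close> can slide through
  \<open>coev\<close>; the next lemma does the same for \<open>evr\<close> and the right dual.\<close>

lemma coev_dual_mor:
  assumes V: "V \<in> Obj C" and W: "W \<in> Obj C" and f: "f \<in> Hom C V W"
  shows "(idm C W \<otimes>\<^sub>m left_dual_mor C V W f) \<bullet> coev C W = (f \<otimes>\<^sub>m idm C (dual C V)) \<bullet> coev C V"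
proof -
  note D = V W f[unfolded Hom_iff]
  let ?x = "(f \<otimes>\<^sub>m idm C (dual C V)) \<bullet> coev C V"
  have "left_dual_mor C V W f = (ev C W \<otimes>\<^sub>m idm C (dual C V)) \<bullet> (idm C (dual C W) \<otimes>\<^sub>m ?x)"
    using D by (simp add: left_dual_mor_def idm_tensor_comp comp_assoc_Mor tensor_Mor_assoc piv_simps)
  then show ?thesis
    using left_mate[of W "dual C V" ?x "\<^bold>1"] D by (simp add: tensor_unit_Mor piv_simps)
qed

lemma evr_dual_mor:
  assumes V: "V \<in> Obj C" and W: "W \<in> Obj C" and f: "f \<in> Hom C V W"
  shows "evr C V \<bullet> (idm C V \<otimes>\<^sub>m right_dual_mor C V W f) = evr C W \<bullet> (f \<otimes>\<^sub>m idm C (dual C W))"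
proof -
  note D = V W f[unfolded Hom_iff]
  let ?y = "evr C W \<bullet> (f \<otimes>\<^sub>m idm C (dual C W))"
  have "right_dual_mor C V W f = (idm C (dual C V) \<otimes>\<^sub>m ?y) \<bullet> (coevr C V \<otimes>\<^sub>m idm C (dual C W))"
    using D by (simp add: right_dual_mor_def idm_tensor_comp comp_assoc_Mor tensor_Mor_assoc piv_simps)
  then show ?thesis
    using right_mate[of V "dual C W" ?y "\<^bold>1"] D by (simp add: tensor_unit_Mor piv_simps)
qed

text \<open>The left canonical morphism arises from \<open>coev\<close> of \<open>U \<otimes> W\<close> by bending first the strand \<open>U\<close> and
  then \<open>W\<close>; straightening them again recovers \<open>coev\<close> of \<open>U \<otimes> W\<close> from the nested one.\<close>

lemma coev_tensor:
  assumes U: "U \<in> Obj C" and W: "W \<in> Obj C"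
  shows "(idm C (U \<otimes>\<^sub>o W) \<otimes>\<^sub>m left_dual_tensor C U W)
      \<bullet> ((idm C U \<otimes>\<^sub>m (coev C W \<otimes>\<^sub>m idm C (dual C U))) \<bullet> coev C U) = coev C (U \<otimes>\<^sub>o W)"
proof -
  note D = U W
  let ?Y = "dual C (U \<otimes>\<^sub>o W)"
  let ?x = "(ev C U \<otimes>\<^sub>m idm C (W \<otimes>\<^sub>o ?Y)) \<bullet> (idm C (dual C U) \<otimes>\<^sub>m coev C (U \<otimes>\<^sub>o W))"
  let ?\<phi> = "(ev C W \<otimes>\<^sub>m idm C ?Y) \<bullet> (idm C (dual C W) \<otimes>\<^sub>m ?x)"
  have \<phi>: "left_dual_tensor C U W = ?\<phi>"
    using D by (simp add: left_dual_tensor_def idm_tensor_comp comp_assoc_Mor tensor_Mor_assoc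
        tensor_idm idm_tensor_idm_tensor piv_simps)
  \<comment> \<open>Straighten \<open>W\<close> here, and \<open>U\<close> in the last step.\<close>
  have x: "(idm C W \<otimes>\<^sub>m ?\<phi>) \<bullet> (coev C W \<otimes>\<^sub>m idm C (dual C U)) = ?x"
    using D by (intro left_mate) (simp_all add: piv_simps)
  have "(idm C (U \<otimes>\<^sub>o W) \<otimes>\<^sub>m ?\<phi>) \<bullet> ((idm C U \<otimes>\<^sub>m (coev C W \<otimes>\<^sub>m idm C (dual C U))) \<bullet> coev C U)
      = (idm C U \<otimes>\<^sub>m ((idm C W \<otimes>\<^sub>m ?\<phi>) \<bullet> (coev C W \<otimes>\<^sub>m idm C (dual C U)))) \<bullet> coev C U"
    using D by (simp add: idm_tensor_comp[of U] idm_tensor_idm_tensor comp_assoc_Mor piv_simps)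
  also have "\<dots> = coev C (U \<otimes>\<^sub>o W)"
    using left_mate[of U "W \<otimes>\<^sub>o ?Y" "coev C (U \<otimes>\<^sub>o W)" "\<^bold>1"] D unfolding x
    by (simp add: tensor_unit_Mor piv_simps)
  finally show ?thesis unfolding \<phi> .
qed

text \<open>Here one straightening suffices, because the right canonical morphism is the mate of the nested
  evaluation with respect to the whole object \<open>U \<otimes> W\<close>.\<close>

lemma evr_tensor:
  assumes U: "U \<in> Obj C" and W: "W \<in> Obj C"
  shows "evr C (U \<otimes>\<^sub>o W) \<bullet> (idm C (U \<otimes>\<^sub>o W) \<otimes>\<^sub>m right_dual_tensor C U W)
      = evr C U \<bullet> (idm C U \<otimes>\<^sub>m (evr C W \<otimes>\<^sub>m idm C (dual C U)))"
proof -
  note D = U W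
  let ?y = "evr C U \<bullet> (idm C U \<otimes>\<^sub>m (evr C W \<otimes>\<^sub>m idm C (dual C U)))"
  have "right_dual_tensor C U W = (idm C (dual C (U \<otimes>\<^sub>o W)) \<otimes>\<^sub>m ?y)
      \<bullet> (coevr C (U \<otimes>\<^sub>o W) \<otimes>\<^sub>m idm C (dual C W \<otimes>\<^sub>o dual C U))"
    using D by (simp add: right_dual_tensor_def idm_tensor_comp comp_assoc_Mor tensor_Mor_assoc
        tensor_idm idm_tensor_idm_tensor piv_simps)
  then show ?thesis
    using right_mate[of "U \<otimes>\<^sub>o W" "dual C W \<otimes>\<^sub>o dual C U" ?y "\<^bold>1"] D
    by (simp add: tensor_unit_Mor piv_simps)
qed

section \<open>Partial traces\<close>

lemma right_ptrace_Hom: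
  assumes "V \<in> Obj C" "X \<in> Obj C" "W \<in> Obj C" "g \<in> Hom C (V \<otimes>\<^sub>o W) (X \<otimes>\<^sub>o W)"
  shows "right_ptrace C V X W g \<in> Hom C V X"
  using assms by (simp add: right_ptrace_def piv_simps)

text \<open>A morphism on the factor that is not traced out can be moved out of the trace: it slides past the
  \<open>evr\<close> closing the loop, and in the next lemma past \<open>coev\<close>.\<close>

lemma right_ptrace_comp_left:
  assumes V: "V \<in> Obj C" and W: "W \<in> Obj C"
    and g: "g \<in> Hom C (V \<otimes>\<^sub>o W) (X \<otimes>\<^sub>o W)" and h: "h \<in> Hom C X Y"
  shows "right_ptrace C V Y W ((h \<otimes>\<^sub>m idm C W) \<bullet> g) = h \<bullet> right_ptrace C V X W g"
proof -
  have "X \<in> Obj C" "Y \<in> Obj C" using h Dom_Obj Cod_Obj by (auto simp: Hom_iff)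
  note D = V W this h[unfolded Hom_iff] g[unfolded Hom_iff]
  let ?r = "(g \<otimes>\<^sub>m idm C (dual C W)) \<bullet> (idm C V \<otimes>\<^sub>m coev C W)"
  have "right_ptrace C V Y W ((h \<otimes>\<^sub>m idm C W) \<bullet> g)
      = ((idm C Y \<otimes>\<^sub>m evr C W) \<bullet> (h \<otimes>\<^sub>m idm C (W \<otimes>\<^sub>o dual C W))) \<bullet> ?r"
    using D by (simp add: right_ptrace_def comp_tensor_idm comp_assoc_Mor tensor_Mor_assoc
        tensor_idm idm_tensor_idm_tensor piv_simps)
  also have "(idm C Y \<otimes>\<^sub>m evr C W) \<bullet> (h \<otimes>\<^sub>m idm C (W \<otimes>\<^sub>o dual C W)) = h \<bullet> (idm C X \<otimes>\<^sub>m evr C W)"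
    using exchange[OF h evr_Hom[OF W]] D by (simp add: tensor_unit_Mor)
  finally show ?thesis
    using D by (simp add: right_ptrace_def comp_assoc_Mor piv_simps)
qed

lemma right_ptrace_comp_right:
  assumes X: "X \<in> Obj C" and W: "W \<in> Obj C"
    and g: "g \<in> Hom C (V \<otimes>\<^sub>o W) (X \<otimes>\<^sub>o W)" and h: "h \<in> Hom C Y V"
  shows "right_ptrace C Y X W (g \<bullet> (h \<otimes>\<^sub>m idm C W)) = right_ptrace C V X W g \<bullet> h"
proof -
  have "Y \<in> Obj C" "V \<in> Obj C" using h Dom_Obj Cod_Obj by (auto simp: Hom_iff)
  note D = X W this h[unfolded Hom_iff] g[unfolded Hom_iff]
  have "right_ptrace C Y X W (g \<bullet> (h \<otimes>\<^sub>m idm C W))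
      = (idm C X \<otimes>\<^sub>m evr C W) \<bullet> ((g \<otimes>\<^sub>m idm C (dual C W)) \<bullet>
         ((h \<otimes>\<^sub>m idm C (W \<otimes>\<^sub>o dual C W)) \<bullet> (idm C Y \<otimes>\<^sub>m coev C W)))"
    using D by (simp add: right_ptrace_def comp_tensor_idm comp_assoc_Mor tensor_Mor_assoc
        tensor_idm idm_tensor_idm_tensor piv_simps)
  also have "(h \<otimes>\<^sub>m idm C (W \<otimes>\<^sub>o dual C W)) \<bullet> (idm C Y \<otimes>\<^sub>m coev C W) = (idm C V \<otimes>\<^sub>m coev C W) \<bullet> h"
    using exchange[OF h coev_Hom[OF W]] D by (simp add: tensor_unit_Mor)
  finally show ?thesis
    using D by (simp add: right_ptrace_def comp_assoc_Mor piv_simps)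
qed

text \<open>The morphism \<open>g\<close> is moved through \<open>evr\<close> as its right dual, carried along the returning
  strand past \<open>h\<close>, and moved through \<open>coev\<close> as its left dual.  Closing the loop is possible
  because the two duals of \<open>g\<close> are equal.\<close>

lemma right_ptrace_cyclic:
  assumes X: "X \<in> Obj C" and Y: "Y \<in> Obj C" and U: "U \<in> Obj C" and V: "V \<in> Obj C"
    and h: "h \<in> Hom C (X \<otimes>\<^sub>o V) (Y \<otimes>\<^sub>o U)" and g: "g \<in> Hom C U V"
  shows "right_ptrace C X Y V ((idm C Y \<otimes>\<^sub>m g) \<bullet> h) = right_ptrace C X Y U (h \<bullet> (idm C X \<otimes>\<^sub>m g))"
proof -
  note D = X Y U V h[unfolded Hom_iff] g[unfolded Hom_iff]
  let ?d = "left_dual_mor C U V g"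
  have d: "?d \<in> Hom C (dual C V) (dual C U)"
    using D by (simp add: left_dual_mor_def piv_simps)
  note D = D d[unfolded Hom_iff]
  have "right_ptrace C X Y V ((idm C Y \<otimes>\<^sub>m g) \<bullet> h)
      = (idm C Y \<otimes>\<^sub>m (evr C V \<bullet> (g \<otimes>\<^sub>m idm C (dual C V)))) \<bullet>
        ((h \<otimes>\<^sub>m idm C (dual C V)) \<bullet> (idm C X \<otimes>\<^sub>m coev C V))"
    using D by (simp add: right_ptrace_def comp_tensor_idm idm_tensor_comp comp_assoc_Mor
        tensor_Mor_assoc piv_simps)
  also have "evr C V \<bullet> (g \<otimes>\<^sub>m idm C (dual C V)) = evr C U \<bullet> (idm C U \<otimes>\<^sub>m ?d)"
    using evr_dual_mor[OF U V g] dual_mor_eq[OF U V g] by simp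
  also have "(idm C Y \<otimes>\<^sub>m (evr C U \<bullet> (idm C U \<otimes>\<^sub>m ?d))) \<bullet>
        ((h \<otimes>\<^sub>m idm C (dual C V)) \<bullet> (idm C X \<otimes>\<^sub>m coev C V))
      = (idm C Y \<otimes>\<^sub>m evr C U) \<bullet> (((idm C (Y \<otimes>\<^sub>o U) \<otimes>\<^sub>m ?d) \<bullet>
        (h \<otimes>\<^sub>m idm C (dual C V))) \<bullet> (idm C X \<otimes>\<^sub>m coev C V))"
    using D by (simp add: idm_tensor_comp idm_tensor_idm_tensor comp_assoc_Mor piv_simps)
  also have "(idm C (Y \<otimes>\<^sub>o U) \<otimes>\<^sub>m ?d) \<bullet> (h \<otimes>\<^sub>m idm C (dual C V))
      = (h \<otimes>\<^sub>m idm C (dual C U)) \<bullet> (idm C (X \<otimes>\<^sub>o V) \<otimes>\<^sub>m ?d)"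
    using exchange[OF h d] by simp
  also have "((h \<otimes>\<^sub>m idm C (dual C U)) \<bullet> (idm C (X \<otimes>\<^sub>o V) \<otimes>\<^sub>m ?d)) \<bullet> (idm C X \<otimes>\<^sub>m coev C V)
      = (h \<otimes>\<^sub>m idm C (dual C U)) \<bullet> (idm C X \<otimes>\<^sub>m ((idm C V \<otimes>\<^sub>m ?d) \<bullet> coev C V))"
    using D by (simp add: idm_tensor_comp idm_tensor_idm_tensor comp_assoc_Mor piv_simps)
  also have "(idm C V \<otimes>\<^sub>m ?d) \<bullet> coev C V = (g \<otimes>\<^sub>m idm C (dual C U)) \<bullet> coev C U"
    by (rule coev_dual_mor[OF U V g])
  also have "(idm C Y \<otimes>\<^sub>m evr C U) \<bullet> ((h \<otimes>\<^sub>m idm C (dual C U)) \<bullet>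
        (idm C X \<otimes>\<^sub>m ((g \<otimes>\<^sub>m idm C (dual C U)) \<bullet> coev C U)))
      = right_ptrace C X Y U (h \<bullet> (idm C X \<otimes>\<^sub>m g))"
    using D by (simp add: right_ptrace_def comp_tensor_idm idm_tensor_comp comp_assoc_Mor
        tensor_Mor_assoc piv_simps)
  finally show ?thesis .
qed

text \<open>The iterated trace closes \<open>U \<otimes> W\<close> with nested loops.  The nested evaluation is \<open>evr\<close> of
  \<open>U \<otimes> W\<close> after the canonical morphism \<open>\<phi>\<close> in its right form; \<open>\<phi>\<close> slides past \<open>g\<close> and turns,
  in its left form, the nested coevaluation into \<open>coev\<close> of \<open>U \<otimes> W\<close>.\<close>

lemma right_ptrace_tensor:
  assumes V: "V \<in> Obj C" and X: "X \<in> Obj C" and U: "U \<in> Obj C" and W: "W \<in> Obj C"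
    and g: "g \<in> Hom C (V \<otimes>\<^sub>o U \<otimes>\<^sub>o W) (X \<otimes>\<^sub>o U \<otimes>\<^sub>o W)"
  shows "right_ptrace C V X (U \<otimes>\<^sub>o W) g
      = right_ptrace C V X U (right_ptrace C (V \<otimes>\<^sub>o U) (X \<otimes>\<^sub>o U) W g)"
proof -
  have g': "g \<in> Hom C (V \<otimes>\<^sub>o (U \<otimes>\<^sub>o W)) (X \<otimes>\<^sub>o (U \<otimes>\<^sub>o W))"
    using g V X U W by (simp add: tensor_Obj_assoc)
  note D = V X U W g'[unfolded Hom_iff]
  let ?UW = "U \<otimes>\<^sub>o W" and ?D = "dual C W \<otimes>\<^sub>o dual C U"
  let ?\<phi> = "left_dual_tensor C U W"
  let ?e = "evr C U \<bullet> (idm C U \<otimes>\<^sub>m (evr C W \<otimes>\<^sub>m idm C (dual C U)))"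
  let ?c = "(idm C U \<otimes>\<^sub>m (coev C W \<otimes>\<^sub>m idm C (dual C U))) \<bullet> coev C U"
  have \<phi>: "?\<phi> \<in> Hom C ?D (dual C ?UW)"
    using D by (simp add: left_dual_tensor_def piv_simps)
  note D = D \<phi>[unfolded Hom_iff]
  have e: "?e = evr C ?UW \<bullet> (idm C ?UW \<otimes>\<^sub>m ?\<phi>)"
    using evr_tensor[OF U W] dual_tensor_eq[OF U W] by simp
  have c: "(idm C ?UW \<otimes>\<^sub>m ?\<phi>) \<bullet> ?c = coev C ?UW"
    by (rule coev_tensor[OF U W])
  have "right_ptrace C V X U (right_ptrace C (V \<otimes>\<^sub>o U) (X \<otimes>\<^sub>o U) W g)
      = (idm C X \<otimes>\<^sub>m ?e) \<bullet> ((g \<otimes>\<^sub>m idm C ?D) \<bullet> (idm C V \<otimes>\<^sub>m ?c))"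
    using D by (simp add: right_ptrace_def comp_tensor_idm idm_tensor_comp comp_assoc_Mor
        tensor_Mor_assoc tensor_idm idm_tensor_idm_tensor piv_simps)
  also have "\<dots> = (idm C X \<otimes>\<^sub>m evr C ?UW) \<bullet> (((idm C (X \<otimes>\<^sub>o ?UW) \<otimes>\<^sub>m ?\<phi>) \<bullet> (g \<otimes>\<^sub>m idm C ?D))
        \<bullet> (idm C V \<otimes>\<^sub>m ?c))"
    unfolding e using D by (simp add: idm_tensor_comp idm_tensor_idm_tensor comp_assoc_Mor piv_simps)
  also have "(idm C (X \<otimes>\<^sub>o ?UW) \<otimes>\<^sub>m ?\<phi>) \<bullet> (g \<otimes>\<^sub>m idm C ?D)
      = (g \<otimes>\<^sub>m idm C (dual C ?UW)) \<bullet> (idm C (V \<otimes>\<^sub>o ?UW) \<otimes>\<^sub>m ?\<phi>)"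
    using exchange[OF g' \<phi>] by simp
  also have "((g \<otimes>\<^sub>m idm C (dual C ?UW)) \<bullet> (idm C (V \<otimes>\<^sub>o ?UW) \<otimes>\<^sub>m ?\<phi>)) \<bullet> (idm C V \<otimes>\<^sub>m ?c)
      = (g \<otimes>\<^sub>m idm C (dual C ?UW)) \<bullet> (idm C V \<otimes>\<^sub>m ((idm C ?UW \<otimes>\<^sub>m ?\<phi>) \<bullet> ?c))"
    using D by (simp add: idm_tensor_comp idm_tensor_idm_tensor comp_assoc_Mor piv_simps)
  also have "(idm C X \<otimes>\<^sub>m evr C ?UW) \<bullet> ((g \<otimes>\<^sub>m idm C (dual C ?UW)) \<bullet>
        (idm C V \<otimes>\<^sub>m ((idm C ?UW \<otimes>\<^sub>m ?\<phi>) \<bullet> ?c))) = right_ptrace C V X ?UW g"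
    unfolding c using D by (simp add: right_ptrace_def comp_assoc_Mor piv_simps)
  finally show ?thesis by simp
qed

lemma right_ptrace_add:
  assumes "V \<in> Obj C" "X \<in> Obj C" "W \<in> Obj C"
    and f: "f \<in> Hom C (V \<otimes>\<^sub>o W) (X \<otimes>\<^sub>o W)" and g: "g \<in> Hom C (V \<otimes>\<^sub>o W) (X \<otimes>\<^sub>o W)"
  shows "right_ptrace C V X W (add_mor C f g) = add_mor C (right_ptrace C V X W f) (right_ptrace C V X W g)"
proof -
  have d: "idm C (dual C W) \<in> Hom C (dual C W) (dual C W)" using assms by (simp add: piv_simps)
  have a: "idm C V \<otimes>\<^sub>m coev C W \<in> Hom C V ((V \<otimes>\<^sub>o W) \<otimes>\<^sub>o dual C W)"
    and b: "idm C X \<otimes>\<^sub>m evr C W \<in> Hom C ((X \<otimes>\<^sub>o W) \<otimes>\<^sub>o dual C W) X"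
    using assms by (simp_all add: piv_simps)
  note f' = tensor_Hom[OF f d] and g' = tensor_Hom[OF g d]
  show ?thesis
    unfolding right_ptrace_def tensor_add_left[OF f g d] comp_add_right[OF f' g' b]
    by (rule comp_add_left[OF a comp_Hom[OF f' b] comp_Hom[OF g' b]])
qed

lemma right_ptrace_scale:
  assumes "V \<in> Obj C" "X \<in> Obj C" "W \<in> Obj C" and k: "k \<in> carrier K"
    and f: "f \<in> Hom C (V \<otimes>\<^sub>o W) (X \<otimes>\<^sub>o W)"
  shows "right_ptrace C V X W (scale_mor C k f) = scale_mor C k (right_ptrace C V X W f)"
proof -
  have d: "idm C (dual C W) \<in> Hom C (dual C W) (dual C W)" using assms by (simp add: piv_simps)
  have a: "idm C V \<otimes>\<^sub>m coev C W \<in> Hom C V ((V \<otimes>\<^sub>o W) \<otimes>\<^sub>o dual C W)"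
    and b: "idm C X \<otimes>\<^sub>m evr C W \<in> Hom C ((X \<otimes>\<^sub>o W) \<otimes>\<^sub>o dual C W) X"
    using assms by (simp_all add: piv_simps)
  note f' = tensor_Hom[OF f d]
  show ?thesis
    unfolding right_ptrace_def tensor_scale_left[OF k f d] comp_scale_right[OF k f' b]
    by (rule comp_scale_left[OF k a comp_Hom[OF f' b]])
qed

end

section \<open>Scalars, coefficients and endomorphisms\<close>

context linear_monoidal_category
begin

lemma hom_module_simps:
  "carrier (hom_module C V W) = Hom C V W" "add (hom_module C V W) = add_mor C"
  "zero (hom_module C V W) = zero_mor C V W" "smult (hom_module C V W) = scale_mor C"
  by (simp_all add: hom_module_def)

lemma hom_module_closed:
  assumes "V \<in> Obj C" "W \<in> Obj C"
  shows "f \<in> Hom C V W \<Longrightarrow> g \<in> Hom C V W \<Longrightarrow> add_mor C f g \<in> Hom C V W"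
    and "k \<in> carrier K \<Longrightarrow> f \<in> Hom C V W \<Longrightarrow> scale_mor C k f \<in> Hom C V W"
    and "zero_mor C V W \<in> Hom C V W"
proof -
  interpret M: module K "hom_module C V W" by (rule hom_is_module[OF assms])
  show "f \<in> Hom C V W \<Longrightarrow> g \<in> Hom C V W \<Longrightarrow> add_mor C f g \<in> Hom C V W"
    using M.a_closed by (simp add: hom_module_simps)
  show "k \<in> carrier K \<Longrightarrow> f \<in> Hom C V W \<Longrightarrow> scale_mor C k f \<in> Hom C V W"
    using M.smult_closed by (simp add: hom_module_simps)
  show "zero_mor C V W \<in> Hom C V W"
    using M.zero_closed by (simp add: hom_module_simps)
qed

lemma zero_add_mor:
  assumes "V \<in> Obj C" "W \<in> Obj C" "f \<in> Hom C V W"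
  shows "add_mor C (zero_mor C V W) f = f"
proof -
  interpret M: module K "hom_module C V W" by (rule hom_is_module[OF assms(1,2)])
  show ?thesis using M.l_zero assms(3) by (simp add: hom_module_simps)
qed

lemma scale_mor_zero:
  assumes "V \<in> Obj C" "W \<in> Obj C" "f \<in> Hom C V W"
  shows "scale_mor C \<zero>\<^bsub>K\<^esub> f = zero_mor C V W"
  using module.smult_l_null[OF hom_is_module[OF assms(1,2)]] assms(3)
  by (simp add: hom_module_simps)

lemma scale_mor_one:
  assumes "V \<in> Obj C" "W \<in> Obj C" "f \<in> Hom C V W"
  shows "scale_mor C \<one>\<^bsub>K\<^esub> f = f"
  using module.smult_one[OF hom_is_module[OF assms(1,2)]] assms(3)
  by (simp add: hom_module_simps)

lemma scale_mor_add:
  assumes "V \<in> Obj C" "W \<in> Obj C" "f \<in> Hom C V W" "k \<in> carrier K" "l \<in> carrier K"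
  shows "scale_mor C (k \<oplus>\<^bsub>K\<^esub> l) f = add_mor C (scale_mor C k f) (scale_mor C l f)"
  using module.smult_l_distr[OF hom_is_module[OF assms(1,2)]] assms(3-)
  by (simp add: hom_module_simps)

lemma scale_mor_mult:
  assumes "V \<in> Obj C" "W \<in> Obj C" "f \<in> Hom C V W" "k \<in> carrier K" "l \<in> carrier K"
  shows "scale_mor C (k \<otimes>\<^bsub>K\<^esub> l) f = scale_mor C k (scale_mor C l f)"
  using module.smult_assoc1[OF hom_is_module[OF assms(1,2)]] assms(3-)
  by (simp add: hom_module_simps)

text \<open>The zero morphism is a multiple of itself by the scalar zero, and scalars pass through composition.\<close>

lemma zero_comp:
  assumes "U \<in> Obj C" "V \<in> Obj C" "W \<in> Obj C" "f \<in> Hom C U V"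
  shows "zero_mor C V W \<bullet> f = zero_mor C U W"
proof -
  have z: "zero_mor C V W \<in> Hom C V W" using assms hom_module_closed by blast
  have "zero_mor C V W \<bullet> f = scale_mor C \<zero>\<^bsub>K\<^esub> (zero_mor C V W) \<bullet> f"
    using assms z by (simp add: scale_mor_zero)
  also have "\<dots> = scale_mor C \<zero>\<^bsub>K\<^esub> (zero_mor C V W \<bullet> f)"
    using assms z by (simp add: comp_scale_left)
  finally show ?thesis
    using comp_Hom[OF assms(4) z] assms by (simp add: scale_mor_zero)
qed

lemma comp_zero:
  assumes "U \<in> Obj C" "V \<in> Obj C" "W \<in> Obj C" "f \<in> Hom C V W"
  shows "f \<bullet> zero_mor C U V = zero_mor C U W"
proof -
  have z: "zero_mor C U V \<in> Hom C U V" using assms hom_module_closed by blast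
  have "f \<bullet> zero_mor C U V = f \<bullet> scale_mor C \<zero>\<^bsub>K\<^esub> (zero_mor C U V)"
    using assms z by (simp add: scale_mor_zero)
  also have "\<dots> = scale_mor C \<zero>\<^bsub>K\<^esub> (f \<bullet> zero_mor C U V)"
    using assms z by (simp add: comp_scale_right)
  finally show ?thesis
    using comp_Hom[OF z assms(4)] assms by (simp add: scale_mor_zero)
qed

lemma coefficient_unique:
  assumes "A \<in> Obj C" "B \<in> Obj C" "free_on_generator K (hom_module C A B) e"
    and "k \<in> carrier K"
  shows "coefficient K C e (scale_mor C k e) = k"
proof -
  have e: "e \<in> Hom C A B"
    and ex: "\<And>y. y \<in> Hom C A B \<Longrightarrow> \<exists>!k. k \<in> carrier K \<and> y = scale_mor C k e"
    using assms(3) by (auto simp: free_on_generator_def hom_module_simps)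
  have "scale_mor C k e \<in> Hom C A B"
    using assms e hom_module_closed by blast
  from ex[OF this] assms(4) show ?thesis
    unfolding coefficient_def by (intro the1_equality) auto
qed

lemma coefficient_exists:
  assumes "free_on_generator K (hom_module C A B) e" "g \<in> Hom C A B"
  shows "coefficient K C e g \<in> carrier K" "g = scale_mor C (coefficient K C e g) e"
proof -
  have "\<exists>!k. k \<in> carrier K \<and> g = scale_mor C k e"
    using assms by (auto simp: free_on_generator_def hom_module_simps)
  from theI'[OF this] show "coefficient K C e g \<in> carrier K" "g = scale_mor C (coefficient K C e g) e"
    unfolding coefficient_def by auto
qed

lemma coefficient_add:
  assumes "A \<in> Obj C" "B \<in> Obj C" "free_on_generator K (hom_module C A B) e"
    and "f \<in> Hom C A B" "g \<in> Hom C A B"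
  shows "coefficient K C e (add_mor C f g) = coefficient K C e f \<oplus>\<^bsub>K\<^esub> coefficient K C e g"
proof -
  have e: "e \<in> Hom C A B"
    using assms(3) by (simp add: free_on_generator_def hom_module_simps)
  note f = coefficient_exists[OF assms(3,4)] and g = coefficient_exists[OF assms(3,5)]
  have "add_mor C f g = scale_mor C (coefficient K C e f \<oplus>\<^bsub>K\<^esub> coefficient K C e g) e"
    using scale_mor_add[OF assms(1,2) e f(1) g(1)] f(2) g(2) by simp
  then show ?thesis
    using coefficient_unique[OF assms(1-3)] f(1) g(1) by simp
qed

lemma coefficient_scale:
  assumes "A \<in> Obj C" "B \<in> Obj C" "free_on_generator K (hom_module C A B) e"
    and "k \<in> carrier K" "f \<in> Hom C A B"
  shows "coefficient K C e (scale_mor C k f) = k \<otimes>\<^bsub>K\<^esub> coefficient K C e f"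
proof -
  have e: "e \<in> Hom C A B"
    using assms(3) by (simp add: free_on_generator_def hom_module_simps)
  note f = coefficient_exists[OF assms(3,5)]
  have "scale_mor C k f = scale_mor C (k \<otimes>\<^bsub>K\<^esub> coefficient K C e f) e"
    using scale_mor_mult[OF assms(1,2) e assms(4) f(1)] f(2) by simp
  then show ?thesis
    using coefficient_unique[OF assms(1-3)] assms(4) f(1) by simp
qed

lemma End_ring_simps:
  "carrier (End_ring C V) = Hom C V V" "mult (End_ring C V) = comp C"
  "one (End_ring C V) = idm C V" "zero (End_ring C V) = zero_mor C V V"
  "add (End_ring C V) = add_mor C"
  by (simp_all add: End_ring_def)

lemma End_pow_Hom:
  assumes "V \<in> Obj C" "f \<in> Hom C V V"
  shows "f [^]\<^bsub>End_ring C V\<^esub> (m :: nat) \<in> Hom C V V"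
  using assms by (induction m) (auto simp: nat_pow_def End_ring_simps intro: idm_Hom comp_Hom)

text \<open>If \<open>f\<close> acts on \<open>x\<close> by a scalar, its powers act by the powers of that scalar; for nilpotent \<open>f\<close>
  the scalar is then nilpotent as soon as \<open>x\<close> is a free generator.\<close>

lemma End_pow_eigen_left:
  assumes "V \<in> Obj C" "A \<in> Obj C" "f \<in> Hom C V V" "x \<in> Hom C A V" "c \<in> carrier K"
    and "f \<bullet> x = scale_mor C c x"
  shows "(f [^]\<^bsub>End_ring C V\<^esub> (m :: nat)) \<bullet> x = scale_mor C (c [^]\<^bsub>K\<^esub> m) x"
proof (induction m)
  case 0
  then show ?case
    using assms by (simp add: nat_pow_def End_ring_simps idm_comp[OF assms(4)] scale_mor_one)
next
  case (Suc m)
  let ?p = "f [^]\<^bsub>End_ring C V\<^esub> m"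
  note p = End_pow_Hom[OF assms(1,3), of m]
  have "(f [^]\<^bsub>End_ring C V\<^esub> Suc m) \<bullet> x = ?p \<bullet> (f \<bullet> x)"
    using comp_assoc[OF assms(4,3) p] by (simp add: nat_pow_def End_ring_simps)
  also have "\<dots> = scale_mor C c (?p \<bullet> x)"
    using comp_scale_right[OF assms(5,4) p] assms(6) by simp
  also have "\<dots> = scale_mor C (c \<otimes>\<^bsub>K\<^esub> c [^]\<^bsub>K\<^esub> m) x"
    using assms by (simp add: Suc.IH scale_mor_mult[of A V])
  finally show ?case
    using assms(5) by (simp add: K.m_comm)
qed

lemma End_pow_eigen_right:
  assumes "V \<in> Obj C" "B \<in> Obj C" "f \<in> Hom C V V" "x \<in> Hom C V B" "c \<in> carrier K"
    and "x \<bullet> f = scale_mor C c x"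
  shows "x \<bullet> (f [^]\<^bsub>End_ring C V\<^esub> (m :: nat)) = scale_mor C (c [^]\<^bsub>K\<^esub> m) x"
proof (induction m)
  case 0
  then show ?case
    using assms by (simp add: nat_pow_def End_ring_simps comp_idm[OF assms(4)] scale_mor_one)
next
  case (Suc m)
  let ?p = "f [^]\<^bsub>End_ring C V\<^esub> m"
  note p = End_pow_Hom[OF assms(1,3), of m]
  have "x \<bullet> (f [^]\<^bsub>End_ring C V\<^esub> Suc m) = (x \<bullet> ?p) \<bullet> f"
    using comp_assoc[OF assms(3) p assms(4)] by (simp add: nat_pow_def End_ring_simps)
  also have "\<dots> = scale_mor C (c [^]\<^bsub>K\<^esub> m) (x \<bullet> f)"
    using comp_scale_left[OF K.nat_pow_closed[OF assms(5)] assms(3,4)] by (simp add: Suc.IH)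
  also have "\<dots> = scale_mor C (c [^]\<^bsub>K\<^esub> m \<otimes>\<^bsub>K\<^esub> c) x"
    using assms by (simp add: scale_mor_mult[of V B])
  finally show ?case by simp
qed

text \<open>Let \<open>k\<close> be the image of the class of \<open>G\<close> under the isomorphism of the residue algebra with the
  ground ring.  The isomorphism is linear and unital, so it also sends the class of \<open>k Id\<close> to
  \<open>k\<close>; by injectivity \<open>G\<close> and \<open>k Id\<close> are congruent modulo the radical.\<close>

lemma absolutely_indecomposable_decomposition:
  assumes V: "V \<in> Obj C" and ai: "absolutely_indecomposable K C V" and G: "G \<in> Hom C V V"
  obtains k n where "k \<in> carrier K" "n \<in> jacobson_radical (End_ring C V)"
    "G = add_mor C n (scale_mor C k (idm C V))"
proof -
  let ?E = "End_ring C V"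
  let ?J = "jacobson_radical ?E"
  obtain \<phi> where iso: "\<phi> \<in> ring_iso (?E Quot ?J) K"
    and lin: "\<And>k f. k \<in> carrier K \<Longrightarrow> f \<in> Hom C V V \<Longrightarrow>
          \<phi> (?J +>\<^bsub>?E\<^esub> scale_mor C k f) = k \<otimes>\<^bsub>K\<^esub> \<phi> (?J +>\<^bsub>?E\<^esub> f)"
    using ai unfolding absolutely_indecomposable_def Let_def by (auto simp: End_ring_simps)
  have coset: "?J +>\<^bsub>?E\<^esub> f \<in> carrier (?E Quot ?J)" if "f \<in> Hom C V V" for f
    using that by (auto simp: FactRing_def A_RCOSETS_def' End_ring_simps)
  have inj: "inj_on \<phi> (carrier (?E Quot ?J))" and closed: "\<phi> \<in> carrier (?E Quot ?J) \<rightarrow> carrier K"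
    using iso by (auto simp: ring_iso_def ring_hom_def bij_betw_def)
  have one: "\<phi> (?J +>\<^bsub>?E\<^esub> idm C V) = \<one>\<^bsub>K\<^esub>"
    using iso by (auto simp: ring_iso_def ring_hom_def FactRing_def End_ring_simps)
  let ?k = "\<phi> (?J +>\<^bsub>?E\<^esub> G)"
  have k: "?k \<in> carrier K" using closed coset[OF G] by auto
  have id: "idm C V \<in> Hom C V V" by (rule idm_Hom[OF V])
  have kid: "scale_mor C ?k (idm C V) \<in> Hom C V V"
    using hom_module_closed(2)[OF V V k id] .
  have "\<phi> (?J +>\<^bsub>?E\<^esub> scale_mor C ?k (idm C V)) = \<phi> (?J +>\<^bsub>?E\<^esub> G)"
    using lin[OF k id] one k by simp
  then have eq: "?J +>\<^bsub>?E\<^esub> scale_mor C ?k (idm C V) = ?J +>\<^bsub>?E\<^esub> G"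
    using inj coset kid G by (auto dest: inj_onD)
  \<comment> \<open>To read \<open>G = n + k Id\<close> off the equality of cosets, \<open>G\<close> must lie in its own coset.\<close>
  have "zero_mor C V V \<in> ?J"
    using hom_module_closed(3)[OF V V]
    by (auto simp: jacobson_radical_def maximal_left_ideal_def left_ideal_def End_ring_simps
        dest!: additive_subgroup.zero_closed)
  moreover have "add_mor C (zero_mor C V V) G = G"
    by (rule zero_add_mor[OF V V G])
  ultimately have "G \<in> ?J +>\<^bsub>?E\<^esub> G"
    by (force simp: a_r_coset_def' End_ring_simps)
  then have "G \<in> ?J +>\<^bsub>?E\<^esub> scale_mor C ?k (idm C V)"
    by (simp only: eq)
  then obtain n where "n \<in> ?J" "G = add_mor C n (scale_mor C ?k (idm C V))"
    by (auto simp: a_r_coset_def' End_ring_simps)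
  then show thesis using that k by blast
qed

lemma pow_in_ideal_power:
  assumes "V \<in> Obj C" "J \<subseteq> Hom C V V" "n \<in> J"
  shows "n [^]\<^bsub>End_ring C V\<^esub> (m :: nat) \<in> ideal_power (End_ring C V) J m"
proof (induction m)
  case 0
  then show ?case using idm_Hom[OF assms(1)] by (simp add: nat_pow_def End_ring_simps)
next
  case (Suc m)
  then show ?case
    using ideal_prod.prod[OF Suc.IH assms(3)] by (simp add: nat_pow_def)
qed

end

section \<open>The scalar by which an endomorphism of P acts\<close>

locale pivotal_trace_tuple =
  pivotal_category K C + K: domain K + trace_tuple K C P \<alpha> \<beta> \<eta> \<epsilon>
  for K :: "('k, 'r) ring_scheme"
    and C :: "('o, 'm, 'k, 'x) pivotal_cat_scheme" (structure)
    and P \<alpha> \<beta> :: 'o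
    and \<eta> \<epsilon> :: 'm
begin

lemma pow_zero_imp_zero:
  assumes "c \<in> carrier K" "c [^]\<^bsub>K\<^esub> (m :: nat) = \<zero>\<^bsub>K\<^esub>"
  shows "c = \<zero>\<^bsub>K\<^esub>"
  using assms by (induction m) (auto dest: K.integral)

text \<open>By freeness \<open>n \<eta> = c \<eta>\<close> and \<open>\<epsilon> n = d \<epsilon>\<close>.  Since \<open>n\<close> is nilpotent, freeness also shows that \<open>c\<close>
  and \<open>d\<close> are nilpotent, and a domain has no nonzero nilpotents.\<close>

lemma radical_annihilates:
  assumes n: "n \<in> jacobson_radical (End_ring C P)"
  shows "n \<bullet> \<eta> = zero_mor C \<alpha> P" and "\<epsilon> \<bullet> n = zero_mor C P \<beta>"
proof -
  have J: "jacobson_radical (End_ring C P) \<subseteq> Hom C P P"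
    by (auto simp: jacobson_radical_def End_ring_simps)
  with n have nP: "n \<in> Hom C P P" by blast
  obtain m where "ideal_power (End_ring C P) (jacobson_radical (End_ring C P)) m = {zero_mor C P P}"
    using P_end_nilpotent by (auto simp: end_nilpotent_def nilpotent_ideal_def End_ring_simps)
  with pow_in_ideal_power[OF P_Obj J n, of m]
  have nil: "n [^]\<^bsub>End_ring C P\<^esub> m = zero_mor C P P" by simp
  let ?c = "coefficient K C \<eta> (n \<bullet> \<eta>)" and ?d = "coefficient K C \<epsilon> (\<epsilon> \<bullet> n)"
  note c = coefficient_exists[OF \<eta>_free comp_Hom[OF \<eta>_Hom nP]]
  note d = coefficient_exists[OF \<epsilon>_free comp_Hom[OF nP \<epsilon>_Hom]]
  have "scale_mor C (?c [^]\<^bsub>K\<^esub> m) \<eta> = scale_mor C \<zero>\<^bsub>K\<^esub> \<eta>"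
    using End_pow_eigen_left[OF P_Obj \<alpha>_Obj nP \<eta>_Hom c, of m] nil
      zero_comp[OF \<alpha>_Obj P_Obj P_Obj \<eta>_Hom] scale_mor_zero[OF \<alpha>_Obj P_Obj \<eta>_Hom] by simp
  from arg_cong[OF this, of "coefficient K C \<eta>"] have "?c [^]\<^bsub>K\<^esub> m = \<zero>\<^bsub>K\<^esub>"
    using coefficient_unique[OF \<alpha>_Obj P_Obj \<eta>_free] c(1) by simp
  from pow_zero_imp_zero[OF c(1) this] show "n \<bullet> \<eta> = zero_mor C \<alpha> P"
    using c(2) scale_mor_zero[OF \<alpha>_Obj P_Obj \<eta>_Hom] by simp
  have "scale_mor C (?d [^]\<^bsub>K\<^esub> m) \<epsilon> = scale_mor C \<zero>\<^bsub>K\<^esub> \<epsilon>"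
    using End_pow_eigen_right[OF P_Obj \<beta>_Obj nP \<epsilon>_Hom d, of m] nil
      comp_zero[OF P_Obj P_Obj \<beta>_Obj \<epsilon>_Hom] scale_mor_zero[OF P_Obj \<beta>_Obj \<epsilon>_Hom] by simp
  from arg_cong[OF this, of "coefficient K C \<epsilon>"] have "?d [^]\<^bsub>K\<^esub> m = \<zero>\<^bsub>K\<^esub>"
    using coefficient_unique[OF P_Obj \<beta>_Obj \<epsilon>_free] d(1) by simp
  from pow_zero_imp_zero[OF d(1) this] show "\<epsilon> \<bullet> n = zero_mor C P \<beta>"
    using d(2) scale_mor_zero[OF P_Obj \<beta>_Obj \<epsilon>_Hom] by simp
qed

text \<open>Write \<open>G = k Id + n\<close> with \<open>n\<close> in the radical; only \<open>k Id\<close> contributes, so both sides are \<open>k\<close>.\<close>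

lemma coefficient_End:
  assumes G: "G \<in> Hom C P P"
  shows "coefficient K C \<eta> (G \<bullet> \<eta>) = coefficient K C \<epsilon> (\<epsilon> \<bullet> G)"
proof -
  let ?id = "idm C P"
  obtain k n where k: "k \<in> carrier K" and n: "n \<in> jacobson_radical (End_ring C P)"
    and Geq: "G = add_mor C n (scale_mor C k ?id)"
    using absolutely_indecomposable_decomposition[OF P_Obj P_absolutely_indecomposable G] .
  have nP: "n \<in> Hom C P P" using n by (simp add: jacobson_radical_def End_ring_simps)
  have id: "?id \<in> Hom C P P" by (rule idm_Hom[OF P_Obj])
  note kid = hom_module_closed(2)[OF P_Obj P_Obj k id]
  have "G \<bullet> \<eta> = add_mor C (zero_mor C \<alpha> P) (scale_mor C k \<eta>)"
    unfolding Geq using comp_add_left[OF \<eta>_Hom nP kid] comp_scale_left[OF k \<eta>_Hom id]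
    by (simp add: radical_annihilates[OF n] idm_comp[OF \<eta>_Hom])
  also have "\<dots> = scale_mor C k \<eta>"
    by (rule zero_add_mor[OF \<alpha>_Obj P_Obj hom_module_closed(2)[OF \<alpha>_Obj P_Obj k \<eta>_Hom]])
  finally have 1: "G \<bullet> \<eta> = scale_mor C k \<eta>" .
  have "\<epsilon> \<bullet> G = add_mor C (zero_mor C P \<beta>) (scale_mor C k \<epsilon>)"
    unfolding Geq using comp_add_right[OF nP kid \<epsilon>_Hom] comp_scale_right[OF k id \<epsilon>_Hom]
    by (simp add: radical_annihilates[OF n] comp_idm[OF \<epsilon>_Hom])
  also have "\<dots> = scale_mor C k \<epsilon>"
    by (rule zero_add_mor[OF P_Obj \<beta>_Obj hom_module_closed(2)[OF P_Obj \<beta>_Obj k \<epsilon>_Hom]])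
  finally have 2: "\<epsilon> \<bullet> G = scale_mor C k \<epsilon>" .
  show ?thesis
    unfolding 1 2 using coefficient_unique[OF \<alpha>_Obj P_Obj \<eta>_free k]
      coefficient_unique[OF P_Obj \<beta>_Obj \<epsilon>_free k] by simp
qed

section \<open>Exchanging sigma and tau\<close>

text \<open>Both sides are the scalar attached by \<open>coefficient_End\<close> to the endomorphism
  \<open>tr(\<tau> f \<sigma> (Id \<otimes> g))\<close> of \<open>P\<close>.  Precomposing with \<open>\<eta>\<close> cancels \<open>\<sigma>\<close>, postcomposing with \<open>\<epsilon>\<close>
  cancels \<open>\<tau>\<close>, and in the second case \<open>g\<close> is moved around the loop.\<close>

lemma sigma_tau_exchange:
  assumes U: "U \<in> Obj C" and V: "V \<in> Obj C"
    and s: "is_sigma C P \<alpha> \<eta> V \<sigma>" and t: "is_tau C P \<beta> \<epsilon> U \<tau>"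
    and f: "f \<in> Hom C (\<alpha> \<otimes>\<^sub>o V) (\<beta> \<otimes>\<^sub>o U)" and g: "g \<in> Hom C U V"
  shows "coefficient K C \<eta> (right_ptrace C \<alpha> P U (\<tau> \<bullet> (f \<bullet> (idm C \<alpha> \<otimes>\<^sub>m g))))
    = coefficient K C \<epsilon> (right_ptrace C P \<beta> V ((idm C \<beta> \<otimes>\<^sub>m g) \<bullet> f \<bullet> \<sigma>))"
proof -
  have \<sigma>: "\<sigma> \<in> Hom C (P \<otimes>\<^sub>o V) (\<alpha> \<otimes>\<^sub>o V)" and \<sigma>1: "\<sigma> \<bullet> (\<eta> \<otimes>\<^sub>m idm C V) = idm C (\<alpha> \<otimes>\<^sub>o V)"
    using s by (auto simp: is_sigma_def)
  have \<tau>: "\<tau> \<in> Hom C (\<beta> \<otimes>\<^sub>o U) (P \<otimes>\<^sub>o U)" and \<tau>1: "(\<epsilon> \<otimes>\<^sub>m idm C U) \<bullet> \<tau> = idm C (\<beta> \<otimes>\<^sub>o U)"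
    using t by (auto simp: is_tau_def)
  note D = U V P_Obj \<alpha>_Obj \<beta>_Obj \<sigma>[unfolded Hom_iff] \<tau>[unfolded Hom_iff] f[unfolded Hom_iff]
    g[unfolded Hom_iff] \<eta>_Hom[unfolded Hom_iff] \<epsilon>_Hom[unfolded Hom_iff]
  let ?h = "f \<bullet> (\<sigma> \<bullet> (idm C P \<otimes>\<^sub>m g))"
  let ?G = "right_ptrace C P P U (\<tau> \<bullet> ?h)"
  have h: "?h \<in> Hom C (P \<otimes>\<^sub>o U) (\<beta> \<otimes>\<^sub>o U)" and \<tau>h: "\<tau> \<bullet> ?h \<in> Hom C (P \<otimes>\<^sub>o U) (P \<otimes>\<^sub>o U)"
    using D by (simp_all add: piv_simps)
  have "?G \<bullet> \<eta> = right_ptrace C \<alpha> P U ((\<tau> \<bullet> ?h) \<bullet> (\<eta> \<otimes>\<^sub>m idm C U))"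
    using right_ptrace_comp_right[OF P_Obj U \<tau>h \<eta>_Hom] by simp
  also have "(\<tau> \<bullet> ?h) \<bullet> (\<eta> \<otimes>\<^sub>m idm C U)
      = \<tau> \<bullet> (f \<bullet> (\<sigma> \<bullet> ((idm C P \<otimes>\<^sub>m g) \<bullet> (\<eta> \<otimes>\<^sub>m idm C U))))"
    using D by (simp add: comp_assoc_Mor piv_simps)
  also have "(idm C P \<otimes>\<^sub>m g) \<bullet> (\<eta> \<otimes>\<^sub>m idm C U) = (\<eta> \<otimes>\<^sub>m idm C V) \<bullet> (idm C \<alpha> \<otimes>\<^sub>m g)"
    using exchange[OF \<eta>_Hom g] by simp
  also have "\<sigma> \<bullet> ((\<eta> \<otimes>\<^sub>m idm C V) \<bullet> (idm C \<alpha> \<otimes>\<^sub>m g)) = (\<sigma> \<bullet> (\<eta> \<otimes>\<^sub>m idm C V)) \<bullet> (idm C \<alpha> \<otimes>\<^sub>m g)"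
    using D by (simp add: comp_assoc_Mor piv_simps)
  also have "\<dots> = idm C \<alpha> \<otimes>\<^sub>m g"
    unfolding \<sigma>1 using D by (simp add: idm_comp_Mor piv_simps)
  finally have l: "?G \<bullet> \<eta> = right_ptrace C \<alpha> P U (\<tau> \<bullet> (f \<bullet> (idm C \<alpha> \<otimes>\<^sub>m g)))" .
  have "\<epsilon> \<bullet> ?G = right_ptrace C P \<beta> U ((\<epsilon> \<otimes>\<^sub>m idm C U) \<bullet> (\<tau> \<bullet> ?h))"
    using right_ptrace_comp_left[OF P_Obj U \<tau>h \<epsilon>_Hom] by simp
  also have "(\<epsilon> \<otimes>\<^sub>m idm C U) \<bullet> (\<tau> \<bullet> ?h) = ((\<epsilon> \<otimes>\<^sub>m idm C U) \<bullet> \<tau>) \<bullet> ?h"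
    using D by (simp add: comp_assoc_Mor piv_simps)
  also have "\<dots> = (f \<bullet> \<sigma>) \<bullet> (idm C P \<otimes>\<^sub>m g)"
    unfolding \<tau>1 using D by (simp add: idm_comp_Mor comp_assoc_Mor piv_simps)
  also have "right_ptrace C P \<beta> U \<dots> = right_ptrace C P \<beta> V ((idm C \<beta> \<otimes>\<^sub>m g) \<bullet> (f \<bullet> \<sigma>))"
    using D by (intro right_ptrace_cyclic[symmetric]) (simp_all add: piv_simps)
  also have "(idm C \<beta> \<otimes>\<^sub>m g) \<bullet> (f \<bullet> \<sigma>) = (idm C \<beta> \<otimes>\<^sub>m g) \<bullet> f \<bullet> \<sigma>"
    using D by (simp add: comp_assoc_Mor piv_simps)
  finally have r: "\<epsilon> \<bullet> ?G = right_ptrace C P \<beta> V ((idm C \<beta> \<otimes>\<^sub>m g) \<bullet> f \<bullet> \<sigma>)" .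
  have "?G \<in> Hom C P P" by (rule right_ptrace_Hom[OF P_Obj P_Obj U \<tau>h])
  from coefficient_End[OF this] show ?thesis unfolding l r .
qed

text \<open>The case \<open>g = Id\<close>: the two formulas for the trace agree, whatever \<open>\<sigma>\<close> and \<open>\<tau>\<close> are.\<close>

lemma sigma_tau_coefficient:
  assumes V: "V \<in> Obj C" and s: "is_sigma C P \<alpha> \<eta> V \<sigma>" and t: "is_tau C P \<beta> \<epsilon> V \<tau>"
    and f: "f \<in> Hom C (\<alpha> \<otimes>\<^sub>o V) (\<beta> \<otimes>\<^sub>o V)"
  shows "coefficient K C \<eta> (right_ptrace C \<alpha> P V (\<tau> \<bullet> f))
    = coefficient K C \<epsilon> (right_ptrace C P \<beta> V (f \<bullet> \<sigma>))"
  using sigma_tau_exchange[OF V V s t f idm_Hom[OF V]] f V \<alpha>_Obj \<beta>_Obj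
  by (simp add: tensor_idm idm_comp_Mor comp_idm_Mor Hom_iff)

section \<open>The right ideal\<close>

lemma is_sigma_tensor:
  assumes V: "V \<in> Obj C" and W: "W \<in> Obj C" and s: "is_sigma C P \<alpha> \<eta> V \<sigma>"
  shows "is_sigma C P \<alpha> \<eta> (V \<otimes>\<^sub>o W) (\<sigma> \<otimes>\<^sub>m idm C W)"
proof -
  have \<sigma>: "\<sigma> \<in> Hom C (P \<otimes>\<^sub>o V) (\<alpha> \<otimes>\<^sub>o V)" and \<sigma>1: "\<sigma> \<bullet> (\<eta> \<otimes>\<^sub>m idm C V) = idm C (\<alpha> \<otimes>\<^sub>o V)"
    using s by (auto simp: is_sigma_def)
  note D = V W P_Obj \<alpha>_Obj \<sigma>[unfolded Hom_iff] \<eta>_Hom[unfolded Hom_iff]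
  have "(\<sigma> \<otimes>\<^sub>m idm C W) \<bullet> (\<eta> \<otimes>\<^sub>m idm C (V \<otimes>\<^sub>o W)) = (\<sigma> \<bullet> (\<eta> \<otimes>\<^sub>m idm C V)) \<otimes>\<^sub>m idm C W"
    using D by (simp add: comp_tensor_idm tensor_Mor_assoc tensor_idm piv_simps)
  then show ?thesis
    unfolding \<sigma>1 using D by (simp add: is_sigma_def tensor_idm piv_simps)
qed

lemma is_tau_tensor:
  assumes V: "V \<in> Obj C" and W: "W \<in> Obj C" and t: "is_tau C P \<beta> \<epsilon> V \<tau>"
  shows "is_tau C P \<beta> \<epsilon> (V \<otimes>\<^sub>o W) (\<tau> \<otimes>\<^sub>m idm C W)"
proof -
  have \<tau>: "\<tau> \<in> Hom C (\<beta> \<otimes>\<^sub>o V) (P \<otimes>\<^sub>o V)" and \<tau>1: "(\<epsilon> \<otimes>\<^sub>m idm C V) \<bullet> \<tau> = idm C (\<beta> \<otimes>\<^sub>o V)"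
    using t by (auto simp: is_tau_def)
  note D = V W P_Obj \<beta>_Obj \<tau>[unfolded Hom_iff] \<epsilon>_Hom[unfolded Hom_iff]
  have "(\<epsilon> \<otimes>\<^sub>m idm C (V \<otimes>\<^sub>o W)) \<bullet> (\<tau> \<otimes>\<^sub>m idm C W) = ((\<epsilon> \<otimes>\<^sub>m idm C V) \<bullet> \<tau>) \<otimes>\<^sub>m idm C W"
    using D by (simp add: comp_tensor_idm tensor_Mor_assoc tensor_idm piv_simps)
  then show ?thesis
    unfolding \<tau>1 using D by (simp add: is_tau_def tensor_idm piv_simps)
qed

text \<open>Conjugate by the inclusion \<open>i\<close> and the projection \<open>p\<close> of the retract; \<open>\<eta>\<close> acts on the other tensor
  factor and commutes with both, leaving \<open>p i = Id\<close>.\<close>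

lemma is_sigma_retract:
  assumes V: "V \<in> Obj C" and W: "W \<in> Obj C" and s: "is_sigma C P \<alpha> \<eta> V \<sigma>"
    and i: "i \<in> Hom C W V" and p: "p \<in> Hom C V W" and pi: "p \<bullet> i = idm C W"
  shows "is_sigma C P \<alpha> \<eta> W ((idm C \<alpha> \<otimes>\<^sub>m p) \<bullet> (\<sigma> \<bullet> (idm C P \<otimes>\<^sub>m i)))"
proof -
  have \<sigma>: "\<sigma> \<in> Hom C (P \<otimes>\<^sub>o V) (\<alpha> \<otimes>\<^sub>o V)" and \<sigma>1: "\<sigma> \<bullet> (\<eta> \<otimes>\<^sub>m idm C V) = idm C (\<alpha> \<otimes>\<^sub>o V)"
    using s by (auto simp: is_sigma_def)
  note D = V W P_Obj \<alpha>_Obj \<sigma>[unfolded Hom_iff] \<eta>_Hom[unfolded Hom_iff] i[unfolded Hom_iff]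
    p[unfolded Hom_iff]
  have "((idm C \<alpha> \<otimes>\<^sub>m p) \<bullet> (\<sigma> \<bullet> (idm C P \<otimes>\<^sub>m i))) \<bullet> (\<eta> \<otimes>\<^sub>m idm C W)
      = (idm C \<alpha> \<otimes>\<^sub>m p) \<bullet> (\<sigma> \<bullet> ((idm C P \<otimes>\<^sub>m i) \<bullet> (\<eta> \<otimes>\<^sub>m idm C W)))"
    using D by (simp add: comp_assoc_Mor piv_simps)
  also have "(idm C P \<otimes>\<^sub>m i) \<bullet> (\<eta> \<otimes>\<^sub>m idm C W) = (\<eta> \<otimes>\<^sub>m idm C V) \<bullet> (idm C \<alpha> \<otimes>\<^sub>m i)"
    using exchange[OF \<eta>_Hom i] by simp
  also have "\<sigma> \<bullet> ((\<eta> \<otimes>\<^sub>m idm C V) \<bullet> (idm C \<alpha> \<otimes>\<^sub>m i)) = (\<sigma> \<bullet> (\<eta> \<otimes>\<^sub>m idm C V)) \<bullet> (idm C \<alpha> \<otimes>\<^sub>m i)"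
    using D by (simp add: comp_assoc_Mor piv_simps)
  also have "(idm C \<alpha> \<otimes>\<^sub>m p) \<bullet> \<dots> = idm C (\<alpha> \<otimes>\<^sub>o W)"
    unfolding \<sigma>1 using D
    by (simp add: idm_comp_Mor idm_tensor_comp[symmetric] pi tensor_idm piv_simps)
  finally show ?thesis
    using D by (simp add: is_sigma_def piv_simps)
qed

lemma is_tau_retract:
  assumes V: "V \<in> Obj C" and W: "W \<in> Obj C" and t: "is_tau C P \<beta> \<epsilon> V \<tau>"
    and i: "i \<in> Hom C W V" and p: "p \<in> Hom C V W" and pi: "p \<bullet> i = idm C W"
  shows "is_tau C P \<beta> \<epsilon> W ((idm C P \<otimes>\<^sub>m p) \<bullet> (\<tau> \<bullet> (idm C \<beta> \<otimes>\<^sub>m i)))"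
proof -
  have \<tau>: "\<tau> \<in> Hom C (\<beta> \<otimes>\<^sub>o V) (P \<otimes>\<^sub>o V)" and \<tau>1: "(\<epsilon> \<otimes>\<^sub>m idm C V) \<bullet> \<tau> = idm C (\<beta> \<otimes>\<^sub>o V)"
    using t by (auto simp: is_tau_def)
  note D = V W P_Obj \<beta>_Obj \<tau>[unfolded Hom_iff] \<epsilon>_Hom[unfolded Hom_iff] i[unfolded Hom_iff]
    p[unfolded Hom_iff]
  have "(\<epsilon> \<otimes>\<^sub>m idm C W) \<bullet> ((idm C P \<otimes>\<^sub>m p) \<bullet> (\<tau> \<bullet> (idm C \<beta> \<otimes>\<^sub>m i)))
      = ((\<epsilon> \<otimes>\<^sub>m idm C W) \<bullet> (idm C P \<otimes>\<^sub>m p)) \<bullet> (\<tau> \<bullet> (idm C \<beta> \<otimes>\<^sub>m i))"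
    using D by (simp add: comp_assoc_Mor piv_simps)
  also have "(\<epsilon> \<otimes>\<^sub>m idm C W) \<bullet> (idm C P \<otimes>\<^sub>m p) = (idm C \<beta> \<otimes>\<^sub>m p) \<bullet> (\<epsilon> \<otimes>\<^sub>m idm C V)"
    using exchange[OF \<epsilon>_Hom p] by simp
  also have "((idm C \<beta> \<otimes>\<^sub>m p) \<bullet> (\<epsilon> \<otimes>\<^sub>m idm C V)) \<bullet> (\<tau> \<bullet> (idm C \<beta> \<otimes>\<^sub>m i))
      = (idm C \<beta> \<otimes>\<^sub>m p) \<bullet> (((\<epsilon> \<otimes>\<^sub>m idm C V) \<bullet> \<tau>) \<bullet> (idm C \<beta> \<otimes>\<^sub>m i))"
    using D by (simp add: comp_assoc_Mor piv_simps)
  also have "\<dots> = idm C (\<beta> \<otimes>\<^sub>o W)"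
    unfolding \<tau>1 using D
    by (simp add: idm_comp_Mor idm_tensor_comp[symmetric] pi tensor_idm piv_simps)
  finally show ?thesis
    using D by (simp add: is_tau_def piv_simps)
qed

lemma right_ideal_I_both: "right_ideal C (I_both C P \<alpha> \<beta> \<eta> \<epsilon>)"
  unfolding right_ideal_def I_both_def I_lower_def I_upper_def
  using is_sigma_tensor is_tau_tensor is_sigma_retract is_tau_retract
  by (auto intro: tensor_Obj) blast+

section \<open>The trace\<close>

definition the_tau :: "'o \<Rightarrow> 'm" where
  "the_tau V = (SOME \<tau>. is_tau C P \<beta> \<epsilon> V \<tau>)"

definition tuple_trace :: "'o \<Rightarrow> 'm \<Rightarrow> 'k" where
  "tuple_trace V f = coefficient K C \<eta> (right_ptrace C \<alpha> P V (the_tau V \<bullet> f))"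

lemma I_bothD:
  assumes "V \<in> I_both C P \<alpha> \<beta> \<eta> \<epsilon>"
  shows "V \<in> Obj C" "\<exists>\<sigma>. is_sigma C P \<alpha> \<eta> V \<sigma>" "is_tau C P \<beta> \<epsilon> V (the_tau V)"
  using assms someI_ex[of "is_tau C P \<beta> \<epsilon> V"]
  by (auto simp: I_both_def I_lower_def I_upper_def the_tau_def)

lemma tuple_trace_sigma:
  assumes "V \<in> I_both C P \<alpha> \<beta> \<eta> \<epsilon>" "f \<in> Hom C (\<alpha> \<otimes>\<^sub>o V) (\<beta> \<otimes>\<^sub>o V)" "is_sigma C P \<alpha> \<eta> V \<sigma>"
  shows "tuple_trace V f = coefficient K C \<epsilon> (right_ptrace C P \<beta> V (f \<bullet> \<sigma>))"
  unfolding tuple_trace_def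
  using sigma_tau_coefficient[OF I_bothD(1)[OF assms(1)] assms(3) I_bothD(3)[OF assms(1)] assms(2)] .

text \<open>Independence of the choice of \<open>\<tau>\<close>: the formula with any fixed \<open>\<sigma>\<close> equals the formula with
  \<open>\<tau>\<close> as well as the one with the chosen \<open>the_tau V\<close>.\<close>

lemma tuple_trace_tau:
  assumes "V \<in> I_both C P \<alpha> \<beta> \<eta> \<epsilon>" "f \<in> Hom C (\<alpha> \<otimes>\<^sub>o V) (\<beta> \<otimes>\<^sub>o V)" "is_tau C P \<beta> \<epsilon> V \<tau>"
  shows "tuple_trace V f = coefficient K C \<eta> (right_ptrace C \<alpha> P V (\<tau> \<bullet> f))"
proof -
  obtain \<sigma> where \<sigma>: "is_sigma C P \<alpha> \<eta> V \<sigma>" using I_bothD(2)[OF assms(1)] by blast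
  show ?thesis
    using tuple_trace_sigma[OF assms(1,2) \<sigma>]
      sigma_tau_coefficient[OF I_bothD(1)[OF assms(1)] \<sigma> assms(3,2)] by simp
qed

text \<open>Linearity and closure are visible in the \<open>\<tau>\<close> formula.  For the partial trace axiom the \<open>\<sigma>\<close>
  formula is used with \<open>\<sigma> \<otimes> Id\<close> on \<open>U \<otimes> W\<close>, which leaves the inner trace over \<open>W\<close>.  Cyclicity is
  \<open>sigma_tau_exchange\<close>, read through the \<open>\<sigma>\<close> formula on \<open>V\<close> and the \<open>\<tau>\<close> formula on \<open>U\<close>.\<close>

lemma right_trace_tuple_trace: "right_trace K C \<alpha> \<beta> (I_both C P \<alpha> \<beta> \<eta> \<epsilon>) tuple_trace"
proof
  let ?I = "I_both C P \<alpha> \<beta> \<eta> \<epsilon>"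
  show "right_ideal C ?I" by (rule right_ideal_I_both)
  have tau: "the_tau V \<in> Hom C (\<beta> \<otimes>\<^sub>o V) (P \<otimes>\<^sub>o V)" if "V \<in> ?I" for V
    using I_bothD(3)[OF that] by (simp add: is_tau_def)
  have tr: "right_ptrace C \<alpha> P V (the_tau V \<bullet> f) \<in> Hom C \<alpha> P"
    if "V \<in> ?I" "f \<in> Hom C (\<alpha> \<otimes>\<^sub>o V) (\<beta> \<otimes>\<^sub>o V)" for V f
    using right_ptrace_Hom[OF \<alpha>_Obj P_Obj I_bothD(1)[OF that(1)] comp_Hom[OF that(2) tau[OF that(1)]]] .
  fix V f assume V: "V \<in> ?I" and f: "f \<in> Hom C (\<alpha> \<otimes>\<^sub>o V) (\<beta> \<otimes>\<^sub>o V)"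
  show "tuple_trace V f \<in> carrier K"
    unfolding tuple_trace_def by (rule coefficient_exists(1)[OF \<eta>_free tr[OF V f]])
  note VO = I_bothD(1)[OF V]
  show "tuple_trace V (add_mor C f g) = tuple_trace V f \<oplus>\<^bsub>K\<^esub> tuple_trace V g"
    if g: "g \<in> Hom C (\<alpha> \<otimes>\<^sub>o V) (\<beta> \<otimes>\<^sub>o V)" for g
    unfolding tuple_trace_def comp_add_right[OF f g tau[OF V]]
      right_ptrace_add[OF \<alpha>_Obj P_Obj VO comp_Hom[OF f tau[OF V]] comp_Hom[OF g tau[OF V]]]
    by (rule coefficient_add[OF \<alpha>_Obj P_Obj \<eta>_free tr[OF V f] tr[OF V g]])
  show "tuple_trace V (scale_mor C k f) = k \<otimes>\<^bsub>K\<^esub> tuple_trace V f" if k: "k \<in> carrier K" for k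
    unfolding tuple_trace_def comp_scale_right[OF k f tau[OF V]]
      right_ptrace_scale[OF \<alpha>_Obj P_Obj VO k comp_Hom[OF f tau[OF V]]]
    by (rule coefficient_scale[OF \<alpha>_Obj P_Obj \<eta>_free k tr[OF V f]])
next
  let ?I = "I_both C P \<alpha> \<beta> \<eta> \<epsilon>"
  fix U W f
  assume U: "U \<in> ?I" and W: "W \<in> Obj C"
    and f: "f \<in> Hom C (\<alpha> \<otimes>\<^sub>o U \<otimes>\<^sub>o W) (\<beta> \<otimes>\<^sub>o U \<otimes>\<^sub>o W)"
  obtain \<sigma> where s: "is_sigma C P \<alpha> \<eta> U \<sigma>" using I_bothD(2)[OF U] by blast
  then have \<sigma>: "\<sigma> \<in> Hom C (P \<otimes>\<^sub>o U) (\<alpha> \<otimes>\<^sub>o U)" by (simp add: is_sigma_def)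
  note UO = I_bothD(1)[OF U]
  note D = UO W P_Obj \<alpha>_Obj \<beta>_Obj
  have UW: "U \<otimes>\<^sub>o W \<in> ?I" using right_ideal_I_both U W by (auto simp: right_ideal_def)
  have f': "f \<in> Hom C (\<alpha> \<otimes>\<^sub>o (U \<otimes>\<^sub>o W)) (\<beta> \<otimes>\<^sub>o (U \<otimes>\<^sub>o W))"
    using f D by (simp add: tensor_Obj_assoc)
  let ?r = "right_ptrace C (\<alpha> \<otimes>\<^sub>o U) (\<beta> \<otimes>\<^sub>o U) W f"
  have r: "?r \<in> Hom C (\<alpha> \<otimes>\<^sub>o U) (\<beta> \<otimes>\<^sub>o U)"
    using right_ptrace_Hom[OF _ _ W f] D by (simp add: tensor_Obj)
  have f\<sigma>: "f \<bullet> (\<sigma> \<otimes>\<^sub>m idm C W) \<in> Hom C (P \<otimes>\<^sub>o U \<otimes>\<^sub>o W) (\<beta> \<otimes>\<^sub>o U \<otimes>\<^sub>o W)"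
    by (rule comp_Hom[OF tensor_Hom[OF \<sigma> idm_Hom[OF W]] f])
  have "tuple_trace (U \<otimes>\<^sub>o W) f
      = coefficient K C \<epsilon> (right_ptrace C P \<beta> (U \<otimes>\<^sub>o W) (f \<bullet> (\<sigma> \<otimes>\<^sub>m idm C W)))"
    by (rule tuple_trace_sigma[OF UW f' is_sigma_tensor[OF UO W s]])
  also have "right_ptrace C P \<beta> (U \<otimes>\<^sub>o W) (f \<bullet> (\<sigma> \<otimes>\<^sub>m idm C W))
      = right_ptrace C P \<beta> U (right_ptrace C (P \<otimes>\<^sub>o U) (\<beta> \<otimes>\<^sub>o U) W (f \<bullet> (\<sigma> \<otimes>\<^sub>m idm C W)))"
    by (rule right_ptrace_tensor[OF P_Obj \<beta>_Obj UO W f\<sigma>])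
  also have "right_ptrace C (P \<otimes>\<^sub>o U) (\<beta> \<otimes>\<^sub>o U) W (f \<bullet> (\<sigma> \<otimes>\<^sub>m idm C W)) = ?r \<bullet> \<sigma>"
    by (rule right_ptrace_comp_right[OF tensor_Obj[OF \<beta>_Obj UO] W f \<sigma>])
  also have "coefficient K C \<epsilon> (right_ptrace C P \<beta> U (?r \<bullet> \<sigma>)) = tuple_trace U ?r"
    by (rule tuple_trace_sigma[OF U r s, symmetric])
  finally show "tuple_trace (U \<otimes>\<^sub>o W) f = tuple_trace U ?r" .
next
  let ?I = "I_both C P \<alpha> \<beta> \<eta> \<epsilon>"
  fix U V f g
  assume U: "U \<in> ?I" and V: "V \<in> ?I" and f: "f \<in> Hom C (\<alpha> \<otimes>\<^sub>o V) (\<beta> \<otimes>\<^sub>o U)" and g: "g \<in> Hom C U V"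
  obtain \<sigma> where s: "is_sigma C P \<alpha> \<eta> V \<sigma>" using I_bothD(2)[OF V] by blast
  have "(idm C \<beta> \<otimes>\<^sub>m g) \<bullet> f \<in> Hom C (\<alpha> \<otimes>\<^sub>o V) (\<beta> \<otimes>\<^sub>o V)"
    by (rule comp_Hom[OF f tensor_Hom[OF idm_Hom[OF \<beta>_Obj] g]])
  from tuple_trace_sigma[OF V this s]
  show "tuple_trace V ((idm C \<beta> \<otimes>\<^sub>m g) \<bullet> f) = tuple_trace U (f \<bullet> (idm C \<alpha> \<otimes>\<^sub>m g))"
    using sigma_tau_exchange[OF I_bothD(1)[OF U] I_bothD(1)[OF V] s I_bothD(3)[OF U] f g]
    by (simp add: tuple_trace_def)
qed

end

theorem theorem4p4:
  fixes K :: "('k, 'r) ring_scheme"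
    and C :: "('o, 'm, 'k, 'x) pivotal_cat_scheme" (structure)
    and P \<alpha> \<beta> :: 'o
    and \<eta> \<epsilon> :: 'm
  assumes "domain K"
    and "pivotal_category K C"
    and "trace_tuple K C P \<alpha> \<beta> \<eta> \<epsilon>"
  shows "\<exists>t. right_trace K C \<alpha> \<beta> (I_both C P \<alpha> \<beta> \<eta> \<epsilon>) t \<and>
    (\<forall>V \<in> I_both C P \<alpha> \<beta> \<eta> \<epsilon>. \<forall>f \<in> Hom C (\<alpha> \<otimes>\<^sub>o V) (\<beta> \<otimes>\<^sub>o V). \<forall>\<sigma> \<tau>.
       is_sigma C P \<alpha> \<eta> V \<sigma> \<longrightarrow> is_tau C P \<beta> \<epsilon> V \<tau> \<longrightarrow>
       t V f = coefficient K C \<eta> (right_ptrace C \<alpha> P V (\<tau> \<bullet> f)) \<and>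
       t V f = coefficient K C \<epsilon> (right_ptrace C P \<beta> V (f \<bullet> \<sigma>)))"
proof -
  interpret pivotal_trace_tuple K C P \<alpha> \<beta> \<eta> \<epsilon>
    using assms by (simp add: pivotal_trace_tuple_def)
  show ?thesis
    using right_trace_tuple_trace tuple_trace_tau tuple_trace_sigma
    by (intro exI[of _ tuple_trace]) blast
qed

end
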